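(* Let $f$ be any smooth function on a domain $\Omega\subset S^2$ and define $Y=Y_f:\Omega\to\mathbf{R}^4_1$ by $$Y_f=\Bigl(Df-\tfrac12(\hat\Delta f)\,\nu\,,\ -\tfrac12[\hat\Delta f+2f]\Bigr).$$ Then $Y$ is marginally trapped. Consequently, if $g$ is any smooth function on $\Omega$ such that $f$ and $g$ agree to second order on $\partial\Omega$, then $Y_g$ (defined by the same formula with $g$ in place of $f$) is a marginally trapped spherical graph over $\Omega$ which agrees with $Y_f$ on $\partial\Omega$.
   Context: $\mathbf{R}^4_1$ is four dimensional Lorentz-Minkowski space, i.e. $\mathbf{R}^4=\mathbf{R}^3\times\mathbf{R}$ with the Lorentzian inner product $v\cdot w=v_1w_1+v_2w_2+v_3w_3-v_4w_4$. $S^2\subset\mathbf{R}^3$ is the unit sphere with its standard metric, $\nu$ denotes the position vector of a point of $\Omega\subset S^2$, $\hat\Delta$ is the Laplacian on $S^2$, and $Df$ is the gradient of $f$ on $S^2$, regarded as an $\mathbf{R}^3$-valued map. Agreeing to second order on $\partial\Omega$ means that the functions and their derivatives of order at most two coincide there. A marginally trapped surface is a space-like surface whose mean curvature vector is isotropic, $\vec H\cdot\vec H\equiv0$. A space-like surface $Y:\Sigma\to\mathbf{R}^4_1$ is a spherical graph if there is a null section of its normal bundle of the form $\xi=(\nu,1)$ such that $\nu:\Sigma\to S^2$ is injective; if $\nu(\Sigma)=\Omega$, it is a spherical graph over $\Omega$. It is then parameterized by $\nu^{-1}$, i.e. written as $Y:\Omega\to\mathbf{R}^4_1$, so that for every $\nu\in\Omega$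 the vector $(\nu,1)$ is normal to $Y$ at $Y(\nu)$. It is called a marginally trapped spherical graph over $\Omega$ if its mean curvature vector satisfies $\vec H_Y\cdot(\nu,1)\equiv0$.
   Formalization: For constant f, Y_f is a single point, so not a space-like surface; "marginally trapped" and "marginally trapped spherical graph" are asserted only at the points of Ω where Y_f (resp. Y_g) is an immersion. Values on ∂Ω are read as limits from inside Ω. *)

theory Defs
  imports "HOL-Analysis.Analysis"
begin

section \<open>Smooth maps on subsets of the sphere\<close>

abbreviation S2 :: "(real^3) set" where
  "S2 \<equiv> sphere 0 1"

definition sphere_domain :: "(real^3) set \<Rightarrow> bool" where
  "sphere_domain \<Omega> \<longleftrightarrow> openin (top_of_set S2) \<Omega> \<and> connected \<Omega> \<and> \<Omega> \<noteq> {}"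

abbreviation sphere_boundary :: "(real^3) set \<Rightarrow> (real^3) set" where
  "sphere_boundary \<Omega> \<equiv> (top_of_set S2) frontier_of \<Omega>"

fun Ck_on :: "nat \<Rightarrow> ('a::euclidean_space \<Rightarrow> 'b::real_normed_vector) \<Rightarrow> 'a set \<Rightarrow> bool" where
  "Ck_on 0 F U \<longleftrightarrow> continuous_on U F"
| "Ck_on (Suc k) F U \<longleftrightarrow> (\<forall>x\<in>U. F differentiable (at x)) \<and>
     (\<forall>v. Ck_on k (\<lambda>x. frechet_derivative F (at x) v) U)"

definition smooth_on_sphere :: "(real^3 \<Rightarrow> 'b::real_normed_vector) \<Rightarrow> (real^3) set \<Rightarrow> bool" where
  "smooth_on_sphere f \<Omega> \<longleftrightarrow>
     (\<forall>p\<in>\<Omega>. \<exists>U F. open U \<and> p \<in> U \<and> (\<forall>k. Ck_on k F U) \<and> (\<forall>x\<in>U \<inter> \<Omega>. F x = f x))"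

section \<open>Calculus on the sphere\<close>

definition tangent_plane :: "real^3 \<Rightarrow> (real^3) set" where
  "tangent_plane p = {v. v \<bullet> p = 0}"

definition tangent_proj :: "real^3 \<Rightarrow> real^3 \<Rightarrow> real^3" where
  "tangent_proj p v = v - (v \<bullet> p) *\<^sub>R p"

text \<open>The differential of a map on \<open>S2\<close> at \<open>p\<close>. A derivative within the sphere is determined
  only on the tangent plane, so it is extended by zero in the normal direction. For a point of a
  relatively open set \<open>\<Omega>\<close> it depends only on the restriction of the map to \<open>\<Omega>\<close>.\<close>

definition sdiff :: "(real^3 \<Rightarrow> 'b::real_normed_vector) \<Rightarrow> real^3 \<Rightarrow> real^3 \<Rightarrow> 'b" where
  "sdiff F p v = frechet_derivative F (at p within S2) (tangent_proj p v)"

definition sgrad :: "(real^3 \<Rightarrow> real) \<Rightarrow> real^3 \<Rightarrow> real^3" where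
  "sgrad f p = (THE w. w \<in> tangent_plane p \<and> (\<forall>v\<in>tangent_plane p. sdiff f p v = w \<bullet> v))"

text \<open>The covariant Hessian as an endomorphism: the Levi-Civita derivative of the gradient field,
  which for a submanifold of Euclidean space is the tangential part of the ambient derivative.\<close>

definition shess :: "(real^3 \<Rightarrow> real) \<Rightarrow> real^3 \<Rightarrow> real^3 \<Rightarrow> real^3" where
  "shess f p v = tangent_proj p (sdiff (sgrad f) p v)"

text \<open>\<open>shess f p\<close> annihilates \<open>p\<close>, so its trace on the ambient space is its trace on the tangent
  plane.\<close>

definition slaplacian :: "(real^3 \<Rightarrow> real) \<Rightarrow> real^3 \<Rightarrow> real" where
  "slaplacian f p = trace (matrix (shess f p))"

section \<open>Space-like surfaces in Lorentz-Minkowski space parameterized over the sphere\<close>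

type_synonym R41 = "(real^3) \<times> real"

definition lorentz :: "R41 \<Rightarrow> R41 \<Rightarrow> real" where
  "lorentz v w = fst v \<bullet> fst w - snd v * snd w"

definition normal_plane :: "(real^3 \<Rightarrow> R41) \<Rightarrow> real^3 \<Rightarrow> R41 set" where
  "normal_plane Y p = {n. \<forall>v\<in>tangent_plane p. lorentz n (sdiff Y p v) = 0}"

definition normal_part :: "(real^3 \<Rightarrow> R41) \<Rightarrow> real^3 \<Rightarrow> R41 \<Rightarrow> R41" where
  "normal_part Y p w = (THE n. n \<in> normal_plane Y p \<and> w - n \<in> sdiff Y p ` tangent_plane p)"

definition spacelike_surface :: "(real^3) set \<Rightarrow> (real^3 \<Rightarrow> R41) \<Rightarrow> bool" where
  "spacelike_surface \<Omega> Y \<longleftrightarrow> openin (top_of_set S2) \<Omega> \<and> smooth_on_sphere Y \<Omega> \<and>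
     (\<forall>p\<in>\<Omega>. \<forall>v\<in>tangent_plane p. v \<noteq> 0 \<longrightarrow> lorentz (sdiff Y p v) (sdiff Y p v) > 0)"

text \<open>For tangent vectors \<open>u\<close>, \<open>v\<close> at \<open>p\<close>, the second fundamental form is the normal part of the
  derivative along \<open>u\<close> of \<open>dY(V)\<close>, for any tangent field \<open>V\<close> with \<open>V(p) = v\<close>. Here \<open>V\<close> is
  the field \<open>q \<mapsto> tangent_proj q v\<close>, for which \<open>dY(V)(q) = sdiff Y q v\<close>.\<close>

definition second_fundamental_form ::
    "(real^3 \<Rightarrow> R41) \<Rightarrow> real^3 \<Rightarrow> real^3 \<Rightarrow> real^3 \<Rightarrow> R41" where
  "second_fundamental_form Y p u v = normal_part Y p (sdiff (\<lambda>q. sdiff Y q v) p u)"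

definition orthonormal_frame ::
    "(real^3 \<Rightarrow> R41) \<Rightarrow> real^3 \<Rightarrow> real^3 \<Rightarrow> real^3 \<Rightarrow> bool" where
  "orthonormal_frame Y p e1 e2 \<longleftrightarrow> e1 \<in> tangent_plane p \<and> e2 \<in> tangent_plane p \<and>
     lorentz (sdiff Y p e1) (sdiff Y p e1) = 1 \<and> lorentz (sdiff Y p e2) (sdiff Y p e2) = 1 \<and>
     lorentz (sdiff Y p e1) (sdiff Y p e2) = 0"

text \<open>Half the trace of the second fundamental form with respect to the induced metric; where \<open>Y\<close>
  is space-like this does not depend on the choice of the frame.\<close>

definition mean_curvature_vector :: "(real^3 \<Rightarrow> R41) \<Rightarrow> real^3 \<Rightarrow> R41" where
  "mean_curvature_vector Y p = (SOME H. \<exists>e1 e2. orthonormal_frame Y p e1 e2 \<and>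
     H = (1/2) *\<^sub>R (second_fundamental_form Y p e1 e1 + second_fundamental_form Y p e2 e2))"

definition marginally_trapped :: "(real^3) set \<Rightarrow> (real^3 \<Rightarrow> R41) \<Rightarrow> bool" where
  "marginally_trapped \<Omega> Y \<longleftrightarrow> spacelike_surface \<Omega> Y \<and>
     (\<forall>p\<in>\<Omega>. lorentz (mean_curvature_vector Y p) (mean_curvature_vector Y p) = 0)"

definition spherical_graph :: "(real^3) set \<Rightarrow> (real^3 \<Rightarrow> R41) \<Rightarrow> bool" where
  "spherical_graph \<Omega> Y \<longleftrightarrow> spacelike_surface \<Omega> Y \<and> (\<forall>\<nu>\<in>\<Omega>. (\<nu>, 1) \<in> normal_plane Y \<nu>)"

definition marginally_trapped_spherical_graph :: "(real^3) set \<Rightarrow> (real^3 \<Rightarrow> R41) \<Rightarrow> bool" where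
  "marginally_trapped_spherical_graph \<Omega> Y \<longleftrightarrow> spherical_graph \<Omega> Y \<and>
     (\<forall>\<nu>\<in>\<Omega>. lorentz (mean_curvature_vector Y \<nu>) (\<nu>, 1) = 0)"

text \<open>The points at which \<open>Y\<close> is an immersion, i.e. at which its image is a surface at all. A map
  such as \<open>Y_of f\<close> below may be singular (for constant \<open>f\<close> it is constant), and curvature
  conditions make sense only away from the singular points. If \<open>Y\<close> is an immersion, this set
  is all of \<open>\<Omega>\<close>.\<close>

definition immersed_part :: "(real^3) set \<Rightarrow> (real^3 \<Rightarrow> R41) \<Rightarrow> (real^3) set" where
  "immersed_part \<Omega> Y = {p\<in>\<Omega>. inj_on (sdiff Y p) (tangent_plane p)}"

section \<open>The construction\<close>

definition Y_of :: "(real^3 \<Rightarrow> real) \<Rightarrow> real^3 \<Rightarrow> R41" where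
  "Y_of f \<nu> = (sgrad f \<nu> - (1/2 * slaplacian f \<nu>) *\<^sub>R \<nu>, - (1/2) * (slaplacian f \<nu> + 2 * f \<nu>))"

text \<open>Functions are smooth on the open set \<open>\<Omega>\<close>; their values (and those of their derivatives) on
  the boundary are the limits from inside \<open>\<Omega>\<close>.\<close>

definition agree_on_boundary ::
    "(real^3) set \<Rightarrow> (real^3 \<Rightarrow> 'b::topological_space) \<Rightarrow> (real^3 \<Rightarrow> 'b) \<Rightarrow> bool" where
  "agree_on_boundary \<Omega> F G \<longleftrightarrow>
     (\<forall>p\<in>sphere_boundary \<Omega>. \<exists>L. (F \<longlongrightarrow> L) (at p within \<Omega>) \<and> (G \<longlongrightarrow> L) (at p within \<Omega>))"

definition agree_to_second_order ::
    "(real^3) set \<Rightarrow> (real^3 \<Rightarrow> real) \<Rightarrow> (real^3 \<Rightarrow> real) \<Rightarrow> bool" where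
  "agree_to_second_order \<Omega> f g \<longleftrightarrow> agree_on_boundary \<Omega> f g \<and>
     agree_on_boundary \<Omega> (sgrad f) (sgrad g) \<and>
     (\<forall>v. agree_on_boundary \<Omega> (\<lambda>p. shess f p v) (\<lambda>p. shess g p v))"

end

theory Submission
  imports Defs
begin

text \<open>
  Fix \<open>p \<in> \<Omega>\<close> and let \<open>A v = Hess f v - (\<Delta> f / 2) v\<close> be the trace-free part of the Hessian at
  \<open>p\<close>. The gradient field satisfies \<open>Df \<bullet> q = 0\<close> along the sphere, so its ambient derivative along
  \<open>v\<close> is \<open>Hess f v - (Df \<bullet> v) p\<close>, and differentiating the formula for \<open>Y = Y_of f\<close> leaves
  \<open>dY(v) = (A v, 0) - b(v) (p, 1)\<close> with \<open>b(v) = d(\<Delta> f)(v) / 2 + Df \<bullet> v\<close> (lemma \<open>sdiff_Y_of\<close>).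
  Everything follows from this decomposition.

  The vector \<open>(p, 1)\<close> is null and \<open>A v\<close> is tangent to the sphere. Hence \<open>(p, 1)\<close> is normal to \<open>Y\<close>,
  and the induced metric is \<open>A v \<bullet> A w\<close>. A symmetric trace-free endomorphism of a Euclidean plane is
  a multiple of a reflection, so this metric is \<open>\<mu> (v \<bullet> w)\<close> for some \<open>\<mu> \<ge> 0\<close>
  (lemma \<open>trace_free_hess_conformal\<close>): \<open>Y\<close> is conformal. Where \<open>A = 0\<close> the image of \<open>dY\<close> lies in a
  line, so \<open>Y\<close> is an immersion exactly where \<open>A \<noteq> 0\<close>; this is an open condition, and there \<open>Y\<close> is
  space-like.

  Differentiating the identity that \<open>dY(v)\<close> and \<open>(q, 1)\<close> are Lorentz orthogonal shows that the second
  fundamental form has the component \<open>- (A v \<bullet> u)\<close> along \<open>(p, 1)\<close>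
  (lemma \<open>second_fundamental_form_null\<close>). A frame that is orthonormal for the induced metric is
  conformally orthonormal for the round one, so tracing gives \<open>- tr A / \<mu> = 0\<close>: the mean curvature
  vector \<open>H\<close> is orthogonal to \<open>(p, 1)\<close>. The normal plane is Lorentzian of dimension two, so the
  orthogonal complement of its null vector \<open>(p, 1)\<close> is spanned by that vector. Thus \<open>H\<close> is a
  multiple of \<open>(p, 1)\<close> and is itself null.

  The boundary values agree because the value of \<open>Y_of f\<close> at \<open>p\<close> is a fixed continuous function
  of \<open>p\<close> and of the value, gradient and Hessian of \<open>f\<close> at \<open>p\<close>.
\<close>

section \<open>Maps of class \<open>C\<^sup>k\<close> on open sets\<close>

lemma Ck_on_cong:
  assumes "open U" "\<And>x. x \<in> U \<Longrightarrow> F x = G x" "Ck_on k F U"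
  shows "Ck_on k G U"
  using assms(2,3)
proof (induction k arbitrary: F G)
  case 0
  then show ?case using continuous_on_cong by fastforce
next
  case (Suc k)
  have deriv: "(G has_derivative frechet_derivative F (at x)) (at x)" if "x \<in> U" for x
    using Suc.prems that assms(1)
    by (metis Ck_on.simps(2) frechet_derivative_works has_derivative_transform_within_open)
  have "frechet_derivative F (at x) = frechet_derivative G (at x)" if "x \<in> U" for x
    using deriv[OF that] frechet_derivative_at by blast
  then have "Ck_on k (\<lambda>x. frechet_derivative G (at x) v) U" for v
    using Suc.IH[of "\<lambda>x. frechet_derivative F (at x) v" "\<lambda>x. frechet_derivative G (at x) v"]
      Suc.prems by simp
  then show ?case using deriv by (auto simp: differentiable_def)
qed

text \<open>Any formula for the derivative that is valid on \<open>U\<close> may be used, because being of class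
  \<open>C\<^sup>k\<close> on an open set depends only on the values there.\<close>

lemma Ck_on_SucI:
  assumes "open U" "\<And>x. x \<in> U \<Longrightarrow> (F has_derivative F' x) (at x)"
    "\<And>v. Ck_on k (\<lambda>x. F' x v) U"
  shows "Ck_on (Suc k) F U"
proof -
  have "F' x = frechet_derivative F (at x)" if "x \<in> U" for x
    using assms(2)[OF that] frechet_derivative_at by blast
  then have "Ck_on k (\<lambda>x. frechet_derivative F (at x) v) U" for v
    using Ck_on_cong[OF assms(1) _ assms(3)[of v]] by simp
  then show ?thesis using assms(2) by (auto simp: differentiable_def)
qed

lemma Ck_on_SucD:
  assumes "Ck_on (Suc k) F U" "x \<in> U"
  shows "(F has_derivative frechet_derivative F (at x)) (at x)"
  using assms frechet_derivative_works by auto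

lemma Ck_on_subset:
  assumes "V \<subseteq> U" "Ck_on k F U" shows "Ck_on k F V"
  using assms(2)
proof (induction k arbitrary: F)
  case 0
  then show ?case using assms(1) continuous_on_subset by auto
next
  case (Suc k)
  then show ?case using assms(1) by auto
qed

lemma Ck_on_add:
  assumes "open U" "Ck_on k F U" "Ck_on k G U"
  shows "Ck_on k (\<lambda>x. F x + G x) U"
  using assms(2,3)
proof (induction k arbitrary: F G)
  case 0
  then show ?case by (auto intro: continuous_intros)
next
  case (Suc k)
  show ?case
  proof (rule Ck_on_SucI[OF assms(1)])
    fix x assume "x \<in> U"
    then show "((\<lambda>x. F x + G x) has_derivative
        (\<lambda>v. frechet_derivative F (at x) v + frechet_derivative G (at x) v)) (at x)"
      using Suc.prems Ck_on_SucD by (blast intro: has_derivative_add)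
  next
    show "Ck_on k (\<lambda>x. frechet_derivative F (at x) v + frechet_derivative G (at x) v) U" for v
      using Suc by simp
  qed
qed

lemma Ck_on_const: "open U \<Longrightarrow> Ck_on k (\<lambda>x. c) U"
  by (induction k arbitrary: c) auto

lemma Ck_on_ident: "open U \<Longrightarrow> Ck_on k (\<lambda>x. x) U"
proof (cases k)
  case (Suc j)
  assume U: "open U"
  show ?thesis unfolding Suc
    by (rule Ck_on_SucI[OF U]) (auto intro: Ck_on_const[OF U] has_derivative_ident)
qed auto

lemma Ck_on_linear:
  assumes "bounded_linear h" "open U" "Ck_on k F U"
  shows "Ck_on k (\<lambda>x. h (F x)) U"
  using assms(3)
proof (induction k arbitrary: F)
  case 0
  then show ?case using bounded_linear.continuous_on[OF assms(1)] by auto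
next
  case (Suc k)
  show ?case
  proof (rule Ck_on_SucI[OF assms(2)])
    fix x assume "x \<in> U"
    then show "((\<lambda>x. h (F x)) has_derivative (\<lambda>v. h (frechet_derivative F (at x) v))) (at x)"
      using Suc.prems Ck_on_SucD bounded_linear.has_derivative[OF assms(1)] by blast
  next
    show "Ck_on k (\<lambda>x. h (frechet_derivative F (at x) v)) U" for v
      using Suc by simp
  qed
qed

text \<open>The induction is on \<open>k\<close> for all smooth factors at once: the product rule pairs a derivative with
  an undifferentiated factor, and smoothness is inherited by derivatives, so that no comparison
  between different orders of differentiability is involved.\<close>

lemma Ck_on_bilinear:
  assumes h: "bounded_bilinear h" and U: "open U"
    and "\<forall>k. Ck_on k F U" "\<forall>k. Ck_on k G U"
  shows "Ck_on k (\<lambda>x. h (F x) (G x)) U"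
  using assms(3,4)
proof (induction k arbitrary: F G)
  case 0
  then show ?case
    using bounded_bilinear.continuous_on[OF h] by (metis Ck_on.simps(1))
next
  case (Suc k)
  show ?case
  proof (rule Ck_on_SucI[OF U])
    fix x assume "x \<in> U"
    then show "((\<lambda>x. h (F x) (G x)) has_derivative
        (\<lambda>v. h (F x) (frechet_derivative G (at x) v) + h (frechet_derivative F (at x) v) (G x))) (at x)"
      by (intro bounded_bilinear.FDERIV[OF h] Ck_on_SucD[of 0 _ U] spec[OF Suc.prems(1)] spec[OF Suc.prems(2)])
  next
    fix v
    have *: "\<forall>k. Ck_on k (\<lambda>x. frechet_derivative F (at x) v) U"
      "\<forall>k. Ck_on k (\<lambda>x. frechet_derivative G (at x) v) U"
      using Suc.prems Ck_on.simps(2) by blast+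
    show "Ck_on k (\<lambda>x. h (F x) (frechet_derivative G (at x) v)
        + h (frechet_derivative F (at x) v) (G x)) U"
      using Ck_on_add[OF U Suc.IH Suc.IH] * Suc.prems by blast
  qed
qed

lemma Ck_on_sum:
  assumes "open U" "finite I" "\<And>i. i \<in> I \<Longrightarrow> Ck_on k (F i) U"
  shows "Ck_on k (\<lambda>x. \<Sum>i\<in>I. F i x) U"
  using assms(2,3)
  by (induction I rule: finite_induct) (auto intro: Ck_on_add Ck_on_const assms(1))

section \<open>Symmetry of second derivatives\<close>

text \<open>Two applications of the mean value theorem, first in the direction \<open>v\<close> to the increments along
  \<open>w\<close>, then in the direction \<open>w\<close>. The left-hand side is symmetric in \<open>v\<close> and \<open>w\<close>, which is what
  yields the symmetry of the mixed derivative in the limit.\<close>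

lemma second_difference_mean_value:
  fixes F :: "'a::euclidean_space \<Rightarrow> real"
  assumes "h > 0" and U: "\<And>s t. \<lbrakk>0 \<le> s; s \<le> h; 0 \<le> t; t \<le> h\<rbrakk> \<Longrightarrow> x + s *\<^sub>R v + t *\<^sub>R w \<in> U"
    and F: "\<And>q. q \<in> U \<Longrightarrow> F differentiable (at q)"
    and F': "\<And>q. q \<in> U \<Longrightarrow> (\<lambda>q. frechet_derivative F (at q) v) differentiable (at q)"
  obtains s t where "0 \<le> s" "s \<le> h" "0 \<le> t" "t \<le> h"
    "F (x + h *\<^sub>R v + h *\<^sub>R w) - F (x + h *\<^sub>R v) - F (x + h *\<^sub>R w) + F x =
     h^2 * frechet_derivative (\<lambda>q. frechet_derivative F (at q) v) (at (x + s *\<^sub>R v + t *\<^sub>R w)) w"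
proof -
  define D where "D q = frechet_derivative F (at q) v" for q
  have line: "((\<lambda>s. G (a + s *\<^sub>R u)) has_real_derivative frechet_derivative G (at (a + s *\<^sub>R u)) u) (at s)"
    if "G differentiable (at (a + s *\<^sub>R u))" for G :: "'a \<Rightarrow> real" and a u s
  proof -
    have "(G has_derivative frechet_derivative G (at (a + s *\<^sub>R u))) (at (a + s *\<^sub>R u))"
      using that frechet_derivative_works by blast
    moreover have "((\<lambda>s. a + s *\<^sub>R u) has_derivative (\<lambda>r. r *\<^sub>R u)) (at s)"
      by (auto intro!: derivative_eq_intros)
    ultimately have "((\<lambda>s. G (a + s *\<^sub>R u)) has_derivative
        (\<lambda>r. frechet_derivative G (at (a + s *\<^sub>R u)) (r *\<^sub>R u))) (at s)"
      by (rule has_derivative_compose[rotated])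
    then show ?thesis
      using linear_frechet_derivative[OF that]
      by (simp add: has_field_derivative_def linear_cmul mult_commute_abs)
  qed
  \<comment> \<open>The second difference is the increment of \<open>g\<close> over \<open>[0, h]\<close>.\<close>
  define g where "g s = F ((x + h *\<^sub>R w) + s *\<^sub>R v) - F (x + s *\<^sub>R v)" for s
  have "(g has_real_derivative (D (x + h *\<^sub>R w + s *\<^sub>R v) - D (x + s *\<^sub>R v))) (at s)"
    if "0 \<le> s" "s \<le> h" for s
    unfolding g_def D_def
    by (intro DERIV_diff line F)
      (use U[of s h] U[of s 0] that \<open>h > 0\<close> in \<open>auto simp: algebra_simps\<close>)
  then obtain s where s: "0 < s" "s < h"
      "g h - g 0 = h * (D (x + h *\<^sub>R w + s *\<^sub>R v) - D (x + s *\<^sub>R v))"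
    using MVT2[OF \<open>h > 0\<close>, of g "\<lambda>s. D (x + h *\<^sub>R w + s *\<^sub>R v) - D (x + s *\<^sub>R v)"] by auto
  have "((\<lambda>t. D ((x + s *\<^sub>R v) + t *\<^sub>R w)) has_real_derivative
      frechet_derivative D (at (x + s *\<^sub>R v + t *\<^sub>R w)) w) (at t)" if "0 \<le> t" "t \<le> h" for t
    by (rule line) (use F'[OF U[of s t]] s that D_def in \<open>auto simp: D_def[abs_def]\<close>)
  then obtain t where t: "0 < t" "t < h"
      "D (x + s *\<^sub>R v + h *\<^sub>R w) - D (x + s *\<^sub>R v) =
        h * frechet_derivative D (at (x + s *\<^sub>R v + t *\<^sub>R w)) w"
    using MVT2[OF \<open>h > 0\<close>, of "\<lambda>t. D ((x + s *\<^sub>R v) + t *\<^sub>R w)"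
        "\<lambda>t. frechet_derivative D (at (x + s *\<^sub>R v + t *\<^sub>R w)) w"] by auto
  have "g h - g 0 = h * (h * frechet_derivative D (at (x + s *\<^sub>R v + t *\<^sub>R w)) w)"
    using s(3) t(3) by (simp add: algebra_simps)
  then show ?thesis
    using that[of s t] s(1,2) t(1,2) by (simp add: g_def D_def[abs_def] power2_eq_square algebra_simps)
qed

text \<open>By continuity both mixed derivatives are within \<open>e\<close> of their values at \<open>x\<close> on a small
  parallelogram. There each of them represents the same second difference, so the values at \<open>x\<close>
  cannot differ by \<open>2 * e\<close>.\<close>

lemma second_derivative_symmetric:
  fixes F :: "'a::euclidean_space \<Rightarrow> real"
  assumes "open U" "x \<in> U" "Ck_on 2 F U"
  shows "frechet_derivative (\<lambda>q. frechet_derivative F (at q) v) (at x) w =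
         frechet_derivative (\<lambda>q. frechet_derivative F (at q) w) (at x) v"
    (is "?P x = ?Q x")
proof (rule ccontr)
  assume neq: "?P x \<noteq> ?Q x"
  define e where "e = \<bar>?P x - ?Q x\<bar> / 2"
  have e: "e > 0" using neq by (simp add: e_def)
  have diff: "F differentiable (at q)" "(\<lambda>q. frechet_derivative F (at q) u) differentiable (at q)"
    if "q \<in> U" for q u
    using assms(3) that by (auto simp: numeral_2_eq_2)
  have "continuous_on U ?P" "continuous_on U ?Q"
    using assms(3) by (auto simp: numeral_2_eq_2)
  then have "isCont ?P x" "isCont ?Q x"
    using assms(1,2) continuous_on_eq_continuous_at by blast+
  then obtain d1 d2 where d12: "d1 > 0" "\<And>q. dist q x < d1 \<Longrightarrow> dist (?P q) (?P x) < e"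
    "d2 > 0" "\<And>q. dist q x < d2 \<Longrightarrow> dist (?Q q) (?Q x) < e"
    unfolding continuous_at_eps_delta using e by (metis dist_norm)
  obtain d3 where d3: "d3 > 0" "\<And>q. dist q x < d3 \<Longrightarrow> q \<in> U"
    using assms(1,2) unfolding open_dist by blast
  define d where "d = min d1 (min d2 d3)"
  have d: "d > 0"
    "\<And>q. dist q x < d \<Longrightarrow> q \<in> U \<and> dist (?P q) (?P x) < e \<and> dist (?Q q) (?Q x) < e"
    using d12 d3 by (auto simp: d_def)
  \<comment> \<open>Small enough for the parallelogram spanned by \<open>h *\<^sub>R v\<close> and \<open>h *\<^sub>R w\<close> to lie within \<open>d\<close> of \<open>x\<close>;
    the summand 1 covers vanishing \<open>v\<close> and \<open>w\<close>.\<close>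
  define h where "h = d / (2 * (norm v + norm w + 1))"
  have n: "norm v + norm w + 1 > 0" by (smt (verit) norm_ge_zero)
  have h: "h > 0" using d(1) n by (simp add: h_def)
  have near: "dist (x + s *\<^sub>R v + t *\<^sub>R w) x < d" if "0 \<le> s" "s \<le> h" "0 \<le> t" "t \<le> h" for s t
  proof -
    have "dist (x + s *\<^sub>R v + t *\<^sub>R w) x \<le> s * norm v + t * norm w"
      using norm_triangle_ineq[of "s *\<^sub>R v" "t *\<^sub>R w"] that by (simp add: dist_norm add.assoc)
    also have "\<dots> \<le> h * norm v + h * norm w"
      using that by (intro add_mono mult_right_mono) auto
    also have "\<dots> = h * (norm v + norm w)" by (simp add: distrib_left)
    also have "\<dots> < h * (2 * (norm v + norm w + 1))"
    proof (rule mult_strict_left_mono[OF _ h])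
      show "norm v + norm w < 2 * (norm v + norm w + 1)" using n by argo
    qed
    also have "\<dots> = d" using n by (simp add: h_def)
    finally show ?thesis .
  qed
  have near': "dist (x + s *\<^sub>R w + t *\<^sub>R v) x < d" if "0 \<le> s" "s \<le> h" "0 \<le> t" "t \<le> h" for s t
    using near[of t s] that by (simp add: algebra_simps)
  obtain s t where P: "0 \<le> s" "s \<le> h" "0 \<le> t" "t \<le> h"
    "F (x + h *\<^sub>R v + h *\<^sub>R w) - F (x + h *\<^sub>R v) - F (x + h *\<^sub>R w) + F x
      = h^2 * ?P (x + s *\<^sub>R v + t *\<^sub>R w)"
  proof (rule second_difference_mean_value[OF h, of x v w U F])
    show "x + s *\<^sub>R v + t *\<^sub>R w \<in> U" if "0 \<le> s" "s \<le> h" "0 \<le> t" "t \<le> h" for s t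
      using near[OF that] d(2) by blast
  qed (use diff in auto)
  obtain s' t' where Q: "0 \<le> s'" "s' \<le> h" "0 \<le> t'" "t' \<le> h"
    "F (x + h *\<^sub>R w + h *\<^sub>R v) - F (x + h *\<^sub>R w) - F (x + h *\<^sub>R v) + F x
      = h^2 * ?Q (x + s' *\<^sub>R w + t' *\<^sub>R v)"
  proof (rule second_difference_mean_value[OF h, of x w v U F])
    show "x + s *\<^sub>R w + t *\<^sub>R v \<in> U" if "0 \<le> s" "s \<le> h" "0 \<le> t" "t \<le> h" for s t
      using near'[OF that] d(2) by blast
  qed (use diff in auto)
  have "h^2 * ?P (x + s *\<^sub>R v + t *\<^sub>R w) = h^2 * ?Q (x + s' *\<^sub>R w + t' *\<^sub>R v)"
    using P(5) Q(5) by (simp add: algebra_simps)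
  then have "?P (x + s *\<^sub>R v + t *\<^sub>R w) = ?Q (x + s' *\<^sub>R w + t' *\<^sub>R v)"
    using h by simp
  moreover have "dist (?P (x + s *\<^sub>R v + t *\<^sub>R w)) (?P x) < e"
    using d(2) near P by blast
  moreover have "dist (?Q (x + s' *\<^sub>R w + t' *\<^sub>R v)) (?Q x) < e"
    using d(2) near' Q by blast
  ultimately show False unfolding e_def dist_real_def by argo
qed

section \<open>Differentials of maps on the sphere\<close>

lemma tangent_proj_tangent: "p \<in> S2 \<Longrightarrow> tangent_proj p v \<in> tangent_plane p"
  by (simp add: tangent_proj_def tangent_plane_def inner_diff_left dot_square_norm)

lemma tangent_proj_ident: "v \<in> tangent_plane p \<Longrightarrow> tangent_proj p v = v"
  by (simp add: tangent_proj_def tangent_plane_def)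

lemma tangent_proj_self: "p \<in> S2 \<Longrightarrow> tangent_proj p p = 0"
  by (simp add: tangent_proj_def dot_square_norm)

lemma linear_tangent_proj: "linear (tangent_proj p)"
  unfolding tangent_proj_def by (intro linearI) (auto simp: algebra_simps inner_add_left)

text \<open>Every tangent direction at \<open>p\<close> is the velocity of a great circle, and along that curve the
  derivative is an ordinary one-variable derivative.\<close>

lemma derivative_along_sphere_unique:
  assumes p: "p \<in> S2" and v: "v \<in> tangent_plane p"
    and D: "(F has_derivative D) (at p within S2)"
    and D': "(F has_derivative D') (at p within S2)"
  shows "D v = D' v"
proof (cases "v = 0")
  case True
  then show ?thesis
    using linear_0[OF has_derivative_linear[OF D]] linear_0[OF has_derivative_linear[OF D']] by simp
next
  case False
  define u where "u = v /\<^sub>R norm v"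
  have u: "u \<bullet> p = 0" "u \<bullet> u = 1" "v = norm v *\<^sub>R u"
    using v False by (auto simp: u_def tangent_plane_def dot_square_norm power2_eq_square)
  have pp: "p \<bullet> p = 1" using p by (simp add: dot_square_norm)
  define c where "c t = cos t *\<^sub>R p + sin t *\<^sub>R u" for t :: real
  have "c t \<bullet> c t = (cos t)\<^sup>2 + (sin t)\<^sup>2" for t
    using u pp inner_commute[of p u]
    by (simp add: c_def inner_add_left inner_add_right power2_eq_square)
  then have "norm (c t) = 1" for t
    by (simp add: norm_eq_1)
  then have c: "range c \<subseteq> S2" by auto
  have c': "(c has_derivative (\<lambda>t. t *\<^sub>R u)) (at 0)"
    unfolding c_def by (auto intro!: derivative_eq_intros)
  have c0: "c 0 = p" by (simp add: c_def)
  have "((\<lambda>t. F (c t)) has_derivative (\<lambda>t. E (t *\<^sub>R u))) (at 0)"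
    if "(F has_derivative E) (at p within S2)" for E
    using has_derivative_in_compose[OF c', of F E] has_derivative_subset[OF that c] c0 by simp
  from has_derivative_unique[OF this[OF D] this[OF D']]
  have "D (norm v *\<^sub>R u) = D' (norm v *\<^sub>R u)" by (rule fun_cong)
  then show ?thesis using u(3) by simp
qed

lemma sdiff_eq:
  assumes "p \<in> S2" "(F has_derivative D) (at p within S2)"
  shows "sdiff F p v = D (tangent_proj p v)"
  unfolding sdiff_def
proof (rule derivative_along_sphere_unique[OF assms(1) tangent_proj_tangent[OF assms(1)] _ assms(2)])
  show "(F has_derivative frechet_derivative F (at p within S2)) (at p within S2)"
    using differentiableI[OF assms(2)] frechet_derivative_works by blast
qed

lemma sdiff_tangent_proj: "p \<in> S2 \<Longrightarrow> sdiff F p (tangent_proj p v) = sdiff F p v"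
  by (simp add: sdiff_def tangent_proj_ident tangent_proj_tangent)

lemma linear_sdiff:
  assumes "F differentiable (at p within S2)"
  shows "linear (sdiff F p)"
  using linear_compose[OF linear_tangent_proj linear_frechet_derivative[OF assms]]
  by (simp add: sdiff_def[abs_def] o_def)

lemma has_derivative_along_sphere_cong:
  assumes "openin (top_of_set S2) \<Omega>" "p \<in> \<Omega>" "open U" "p \<in> U"
    "\<And>x. x \<in> U \<inter> \<Omega> \<Longrightarrow> F x = G x" "(F has_derivative D) (at p within S2)"
  shows "(G has_derivative D) (at p within S2)"
proof -
  obtain T where T: "open T" "\<Omega> = S2 \<inter> T" using assms(1) openin_open by blast
  have "eventually (\<lambda>x. x \<in> U \<inter> T) (nhds p)"
    using T assms eventually_nhds by blast
  then have "eventually (\<lambda>x. F x = G x) (at p within S2)"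
    unfolding eventually_at_filter using T assms(5) by (auto elim!: eventually_mono)
  then show ?thesis
    using has_derivative_transform_eventually[OF assms(6)] T assms by auto
qed

lemma smooth_extension:
  assumes "openin (top_of_set S2) \<Omega>" "smooth_on_sphere F \<Omega>" "p \<in> \<Omega>"
  obtains U E where "open U" "p \<in> U" "\<And>k. Ck_on k E U" "\<And>q. q \<in> U \<inter> \<Omega> \<Longrightarrow> E q = F q"
    "\<And>q. q \<in> U \<inter> \<Omega> \<Longrightarrow> (F has_derivative frechet_derivative E (at q)) (at q within S2)"
proof -
  obtain U E where U: "open U" "p \<in> U" "\<And>k. Ck_on k E U" "\<And>q. q \<in> U \<inter> \<Omega> \<Longrightarrow> E q = F q"
    using assms(2,3) unfolding smooth_on_sphere_def by metis
  have "(F has_derivative frechet_derivative E (at q)) (at q within S2)" if "q \<in> U \<inter> \<Omega>" for q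
    using has_derivative_along_sphere_cong[of \<Omega> q U E F] assms(1) U that Ck_on_SucD[of 0 E U q]
      has_derivative_at_withinI by blast
  then show ?thesis using that U by blast
qed

lemma smooth_differentiable:
  assumes "openin (top_of_set S2) \<Omega>" "smooth_on_sphere F \<Omega>" "p \<in> \<Omega>"
  shows "F differentiable (at p within S2)"
proof -
  obtain U E where "open U" "p \<in> U" "\<And>k. Ck_on k E U" "\<And>q. q \<in> U \<inter> \<Omega> \<Longrightarrow> E q = F q"
    "\<And>q. q \<in> U \<inter> \<Omega> \<Longrightarrow> (F has_derivative frechet_derivative E (at q)) (at q within S2)"
    by (rule smooth_extension[OF assms]) (rule that)
  then show ?thesis using assms(3) differentiableI by blast
qed

lemma smooth_has_derivative:
  assumes "openin (top_of_set S2) \<Omega>" "smooth_on_sphere F \<Omega>" "p \<in> \<Omega>"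
  obtains D where "(F has_derivative D) (at p within S2)"
    "\<And>v. v \<in> tangent_plane p \<Longrightarrow> D v = sdiff F p v"
proof -
  have "p \<in> S2" using assms(1,3) openin_imp_subset by blast
  moreover obtain D where D: "(F has_derivative D) (at p within S2)"
    using smooth_differentiable[OF assms] differentiable_def by blast
  ultimately have "D v = sdiff F p v" if "v \<in> tangent_plane p" for v
    using sdiff_eq[OF _ D] tangent_proj_ident[OF that] by simp
  then show ?thesis using that D by blast
qed

lemma smooth_continuous:
  assumes "openin (top_of_set S2) \<Omega>" "smooth_on_sphere F \<Omega>"
  shows "continuous_on \<Omega> F"
proof -
  have "\<Omega> \<subseteq> S2" using assms(1) openin_imp_subset by blast
  then have "continuous (at p within \<Omega>) F" if "p \<in> \<Omega>" for p
    using differentiable_imp_continuous_within[OF smooth_differentiable[OF assms that]]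
      continuous_within_subset by blast
  then show ?thesis
    using continuous_on_eq_continuous_within by blast
qed

lemma smooth_on_sphere_local:
  assumes "\<And>p. p \<in> \<Omega> \<Longrightarrow> \<exists>U E. open U \<and> p \<in> U \<and> (\<forall>k. Ck_on k E U) \<and> (\<forall>x\<in>U \<inter> \<Omega>. E x = F x)"
  shows "smooth_on_sphere F \<Omega>"
  using assms unfolding smooth_on_sphere_def by simp

lemma smooth_on_sphere_cong:
  assumes "\<And>x. x \<in> \<Omega> \<Longrightarrow> F x = G x" "smooth_on_sphere F \<Omega>"
  shows "smooth_on_sphere G \<Omega>"
proof (rule smooth_on_sphere_local)
  fix p assume "p \<in> \<Omega>"
  then obtain U E where "open U" "p \<in> U" "\<forall>k. Ck_on k E U" "\<forall>x\<in>U \<inter> \<Omega>. E x = F x"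
    using assms(2) unfolding smooth_on_sphere_def by meson
  then show "\<exists>U E. open U \<and> p \<in> U \<and> (\<forall>k. Ck_on k E U) \<and> (\<forall>x\<in>U \<inter> \<Omega>. E x = G x)"
    using assms(1) by (intro exI[of _ U] exI[of _ E]) auto
qed

lemma smooth_on_sphere_subset:
  assumes "smooth_on_sphere F \<Omega>" "\<Omega>' \<subseteq> \<Omega>"
  shows "smooth_on_sphere F \<Omega>'"
proof (rule smooth_on_sphere_local)
  fix p assume "p \<in> \<Omega>'"
  then obtain U E where "open U" "p \<in> U" "\<forall>k. Ck_on k E U" "\<forall>x\<in>U \<inter> \<Omega>. E x = F x"
    using assms unfolding smooth_on_sphere_def by (meson subsetD)
  then show "\<exists>U E. open U \<and> p \<in> U \<and> (\<forall>k. Ck_on k E U) \<and> (\<forall>x\<in>U \<inter> \<Omega>'. E x = F x)"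
    using assms(2) by (intro exI[of _ U] exI[of _ E]) auto
qed

lemma smooth_on_sphere_const: "smooth_on_sphere (\<lambda>x. c) \<Omega>"
  by (rule smooth_on_sphere_local) (use Ck_on_const[of UNIV] in auto)

lemma smooth_on_sphere_ident: "smooth_on_sphere (\<lambda>x. x) \<Omega>"
  by (rule smooth_on_sphere_local) (use Ck_on_ident[of UNIV] in auto)

lemma smooth_on_sphere_linear:
  assumes "bounded_linear h" "smooth_on_sphere F \<Omega>"
  shows "smooth_on_sphere (\<lambda>x. h (F x)) \<Omega>"
proof (rule smooth_on_sphere_local)
  fix p assume "p \<in> \<Omega>"
  then obtain U E where "open U" "p \<in> U" "\<forall>k. Ck_on k E U" "\<forall>x\<in>U \<inter> \<Omega>. E x = F x"
    using assms(2) unfolding smooth_on_sphere_def by meson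
  then show "\<exists>U E. open U \<and> p \<in> U \<and> (\<forall>k. Ck_on k E U) \<and> (\<forall>x\<in>U \<inter> \<Omega>. E x = h (F x))"
    by (intro exI[of _ U] exI[of _ "\<lambda>x. h (E x)"] conjI allI Ck_on_linear[OF assms(1)]) auto
qed

lemma smooth_on_sphere_bilinear:
  assumes "bounded_bilinear h" "smooth_on_sphere F \<Omega>" "smooth_on_sphere G \<Omega>"
  shows "smooth_on_sphere (\<lambda>x. h (F x) (G x)) \<Omega>"
proof (rule smooth_on_sphere_local)
  fix p assume p: "p \<in> \<Omega>"
  obtain U E where U: "open U" "p \<in> U" "\<forall>k. Ck_on k E U" "\<forall>x\<in>U \<inter> \<Omega>. E x = F x"
    using assms(2) p unfolding smooth_on_sphere_def by meson
  obtain V H where V: "open V" "p \<in> V" "\<forall>k. Ck_on k H V" "\<forall>x\<in>V \<inter> \<Omega>. H x = G x"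
    using assms(3) p unfolding smooth_on_sphere_def by meson
  have "\<forall>k. Ck_on k E (U \<inter> V)" "\<forall>k. Ck_on k H (U \<inter> V)"
    using U(3) V(3) Ck_on_subset[OF Int_lower1] Ck_on_subset[OF Int_lower2] by blast+
  then have "\<forall>k. Ck_on k (\<lambda>x. h (E x) (H x)) (U \<inter> V)"
    using Ck_on_bilinear[OF assms(1)] U(1) V(1) by blast
  then show "\<exists>U E. open U \<and> p \<in> U \<and> (\<forall>k. Ck_on k E U) \<and> (\<forall>x\<in>U \<inter> \<Omega>. E x = h (F x) (G x))"
    using U V by (intro exI[of _ "U \<inter> V"] exI[of _ "\<lambda>x. h (E x) (H x)"]) auto
qed

lemma smooth_on_sphere_add:
  assumes "smooth_on_sphere F \<Omega>" "smooth_on_sphere G \<Omega>"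
  shows "smooth_on_sphere (\<lambda>x. F x + G x) \<Omega>"
proof (rule smooth_on_sphere_local)
  fix p assume p: "p \<in> \<Omega>"
  obtain U E where U: "open U" "p \<in> U" "\<forall>k. Ck_on k E U" "\<forall>x\<in>U \<inter> \<Omega>. E x = F x"
    using assms(1) p unfolding smooth_on_sphere_def by meson
  obtain V H where V: "open V" "p \<in> V" "\<forall>k. Ck_on k H V" "\<forall>x\<in>V \<inter> \<Omega>. H x = G x"
    using assms(2) p unfolding smooth_on_sphere_def by meson
  have "\<forall>k. Ck_on k E (U \<inter> V)" "\<forall>k. Ck_on k H (U \<inter> V)"
    using U(3) V(3) Ck_on_subset[OF Int_lower1] Ck_on_subset[OF Int_lower2] by blast+
  then have "\<forall>k. Ck_on k (\<lambda>x. E x + H x) (U \<inter> V)"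
    using Ck_on_add U(1) V(1) by blast
  then show "\<exists>U E. open U \<and> p \<in> U \<and> (\<forall>k. Ck_on k E U) \<and> (\<forall>x\<in>U \<inter> \<Omega>. E x = F x + G x)"
    using U V by (intro exI[of _ "U \<inter> V"] exI[of _ "\<lambda>x. E x + H x"]) auto
qed

lemma smooth_on_sphere_diff:
  assumes "smooth_on_sphere F \<Omega>" "smooth_on_sphere G \<Omega>"
  shows "smooth_on_sphere (\<lambda>x. F x - G x) \<Omega>"
  using smooth_on_sphere_add[OF assms(1)
      smooth_on_sphere_linear[OF bounded_linear_minus[OF bounded_linear_ident] assms(2)]] by simp

lemma smooth_on_sphere_sum:
  assumes "finite I" "\<And>i. i \<in> I \<Longrightarrow> smooth_on_sphere (F i) \<Omega>"
  shows "smooth_on_sphere (\<lambda>x. \<Sum>i\<in>I. F i x) \<Omega>"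
  using assms by (induction I rule: finite_induct)
    (auto intro: smooth_on_sphere_add smooth_on_sphere_const)

lemma smooth_on_sphere_tangent_proj:
  assumes "smooth_on_sphere F \<Omega>"
  shows "smooth_on_sphere (\<lambda>q. tangent_proj q (F q)) \<Omega>"
  unfolding tangent_proj_def
  by (intro smooth_on_sphere_diff smooth_on_sphere_bilinear[OF bounded_bilinear_scaleR]
      smooth_on_sphere_bilinear[OF bounded_bilinear_inner] assms smooth_on_sphere_ident)

lemma linear_expansion:
  fixes L :: "'a::euclidean_space \<Rightarrow> 'b::real_vector"
  assumes "linear L" shows "L v = (\<Sum>b\<in>Basis. (v \<bullet> b) *\<^sub>R L b)"
proof -
  have "L v = L (\<Sum>b\<in>Basis. (v \<bullet> b) *\<^sub>R b)" by (simp add: euclidean_representation)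
  also have "\<dots> = (\<Sum>b\<in>Basis. (v \<bullet> b) *\<^sub>R L b)"
    by (simp add: linear_sum[OF assms] linear_cmul[OF assms])
  finally show ?thesis .
qed

text \<open>If \<open>E\<close> extends \<open>F\<close> locally, then the sum over the standard basis of the products of
  \<open>tangent_proj q v \<bullet> b\<close> with the derivative of \<open>E\<close> along \<open>b\<close> is a smooth extension of the
  differential: the direction moves with \<open>q\<close>, so it has to be expanded into fixed directions.\<close>

lemma smooth_on_sphere_sdiff:
  assumes \<Omega>: "openin (top_of_set S2) \<Omega>" and F: "smooth_on_sphere F \<Omega>"
  shows "smooth_on_sphere (\<lambda>q. sdiff F q v) \<Omega>"
proof (rule smooth_on_sphere_local)
  fix p assume p: "p \<in> \<Omega>"
  obtain U E where U: "open U" "p \<in> U" "\<And>k. Ck_on k E U" "\<And>q. q \<in> U \<inter> \<Omega> \<Longrightarrow> E q = F q"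
    "\<And>q. q \<in> U \<inter> \<Omega> \<Longrightarrow> (F has_derivative frechet_derivative E (at q)) (at q within S2)"
    by (rule smooth_extension[OF \<Omega> F p]) (rule that)
  define H where "H q = (\<Sum>b\<in>Basis. (tangent_proj q v \<bullet> b) *\<^sub>R frechet_derivative E (at q) b)" for q
  have "Ck_on k H U" for k
    unfolding H_def tangent_proj_def
  proof (intro Ck_on_sum Ck_on_bilinear[OF bounded_bilinear_scaleR] allI
      Ck_on_bilinear[OF bounded_bilinear_inner] U(1) Ck_on_const finite_Basis)
    show "Ck_on j (\<lambda>q. frechet_derivative E (at q) b) U" for j b
      using U(3)[of "Suc j"] by simp
    have "Ck_on j (\<lambda>q. v + - (v \<bullet> q) *\<^sub>R q) U" for j
      by (intro Ck_on_add Ck_on_bilinear[OF bounded_bilinear_scaleR] allI U(1) Ck_on_const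
          Ck_on_ident Ck_on_linear[OF bounded_linear_minus[OF bounded_linear_inner_right]])
    then show "Ck_on j (\<lambda>q. v - (v \<bullet> q) *\<^sub>R q) U" for j
      by simp
  qed
  moreover have "H q = sdiff F q v" if q: "q \<in> U \<inter> \<Omega>" for q
  proof -
    have "q \<in> S2" using \<Omega> q openin_imp_subset by blast
    then have "sdiff F q v = frechet_derivative E (at q) (tangent_proj q v)"
      using sdiff_eq U(5)[OF q] by blast
    then show ?thesis
      using linear_expansion[OF has_derivative_linear[OF U(5)[OF q]], of "tangent_proj q v"]
      by (simp add: H_def)
  qed
  ultimately show "\<exists>U E. open U \<and> p \<in> U \<and> (\<forall>k. Ck_on k E U) \<and> (\<forall>x\<in>U \<inter> \<Omega>. E x = sdiff F x v)"
    using U by blast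
qed

section \<open>Gradient, Hessian and Laplacian\<close>

context
  fixes \<Omega> :: "(real^3) set" and f :: "real^3 \<Rightarrow> real"
  assumes \<Omega>: "openin (top_of_set S2) \<Omega>" and f: "smooth_on_sphere f \<Omega>"
begin

lemma domain_in_sphere: "p \<in> \<Omega> \<Longrightarrow> p \<in> S2"
  using \<Omega> openin_imp_subset by blast

text \<open>Since \<open>sdiff f p\<close> vanishes on \<open>p\<close>, the vector that represents it on the whole ambient space is
  already tangent.\<close>

lemma sgrad_eq:
  assumes p: "p \<in> \<Omega>" shows "sgrad f p = (\<Sum>b\<in>Basis. sdiff f p b *\<^sub>R b)"
proof -
  let ?w = "\<Sum>b\<in>Basis. sdiff f p b *\<^sub>R b"
  have lin: "linear (sdiff f p)"
    using linear_sdiff smooth_differentiable[OF \<Omega> f p] by blast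
  have w: "?w \<bullet> v = sdiff f p v" for v
    unfolding inner_sum_left linear_expansion[OF lin, of v]
    by (simp add: inner_commute mult.commute)
  have "tangent_proj p p = 0"
    by (rule tangent_proj_self[OF domain_in_sphere[OF p]])
  then have "sdiff f p p = 0"
    using sdiff_tangent_proj[OF domain_in_sphere[OF p], of f p] linear_0[OF lin] by simp
  then have tang: "?w \<in> tangent_plane p"
    unfolding tangent_plane_def using w[of p] by simp
  show ?thesis
    unfolding sgrad_def
  proof (rule the_equality)
    show "?w \<in> tangent_plane p \<and> (\<forall>v\<in>tangent_plane p. sdiff f p v = ?w \<bullet> v)"
      using tang w by simp
  next
    fix z assume z: "z \<in> tangent_plane p \<and> (\<forall>v\<in>tangent_plane p. sdiff f p v = z \<bullet> v)"
    have "z - ?w \<in> tangent_plane p"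
      using tang z by (simp add: tangent_plane_def inner_diff_left)
    then have "(z - ?w) \<bullet> (z - ?w) = 0"
      using z w by (simp add: inner_diff_left)
    then show "z = ?w" by simp
  qed
qed

lemma sgrad_inner:
  assumes p: "p \<in> \<Omega>" shows "sgrad f p \<bullet> v = sdiff f p v"
  unfolding sgrad_eq[OF p] inner_sum_left
    linear_expansion[OF linear_sdiff[OF smooth_differentiable[OF \<Omega> f p]], of v]
  by (simp add: inner_commute mult.commute)

lemma sgrad_normal: assumes p: "p \<in> \<Omega>" shows "sgrad f p \<bullet> p = 0"
proof -
  have "tangent_proj p p = 0"
    by (rule tangent_proj_self[OF domain_in_sphere[OF p]])
  then show ?thesis
    using sgrad_inner[OF p] sdiff_tangent_proj[OF domain_in_sphere[OF p], of f p]
      linear_0[OF linear_sdiff[OF smooth_differentiable[OF \<Omega> f p]]] by simp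
qed

lemma smooth_sgrad: "smooth_on_sphere (sgrad f) \<Omega>"
proof (rule smooth_on_sphere_cong[of _ "\<lambda>p. \<Sum>b\<in>Basis. sdiff f p b *\<^sub>R b"])
  show "smooth_on_sphere (\<lambda>p. \<Sum>b\<in>Basis. sdiff f p b *\<^sub>R b) \<Omega>"
    by (intro smooth_on_sphere_sum smooth_on_sphere_linear[OF bounded_linear_scaleR_left]
        smooth_on_sphere_sdiff \<Omega> f finite_Basis)
qed (simp add: sgrad_eq)

lemma smooth_shess: "smooth_on_sphere (\<lambda>p. shess f p v) \<Omega>"
  unfolding shess_def
  by (intro smooth_on_sphere_tangent_proj smooth_on_sphere_sdiff \<Omega> smooth_sgrad)

lemma slaplacian_eq: "slaplacian h p = (\<Sum>i\<in>UNIV. shess h p (axis i 1) $ i)"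
  by (simp add: slaplacian_def trace_def matrix_def)

lemma smooth_slaplacian: "smooth_on_sphere (slaplacian f) \<Omega>"
  unfolding slaplacian_eq[abs_def]
  by (intro smooth_on_sphere_sum smooth_on_sphere_linear[OF bounded_linear_vec_nth] smooth_shess) auto

lemma linear_shess: assumes p: "p \<in> \<Omega>" shows "linear (shess f p)"
  using linear_compose[OF linear_sdiff[OF smooth_differentiable[OF \<Omega> smooth_sgrad p]] linear_tangent_proj]
  by (simp add: shess_def[abs_def] o_def)

lemma shess_tangent: "p \<in> \<Omega> \<Longrightarrow> shess f p v \<in> tangent_plane p"
  unfolding shess_def using tangent_proj_tangent domain_in_sphere by blast

lemma shess_normal: assumes p: "p \<in> \<Omega>" shows "shess f p p = 0"
proof -
  have "tangent_proj p p = 0"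
    by (rule tangent_proj_self[OF domain_in_sphere[OF p]])
  then show ?thesis
    unfolding shess_def
    using sdiff_tangent_proj[OF domain_in_sphere[OF p], of "sgrad f" p]
      linear_0[OF linear_sdiff[OF smooth_differentiable[OF \<Omega> smooth_sgrad p]]]
      linear_0[OF linear_tangent_proj] by simp
qed

text \<open>For a local extension \<open>E\<close> of \<open>f\<close> and tangent vectors \<open>a\<close>, \<open>b\<close>, the Hessian form is the ambient
  second derivative of \<open>E\<close> minus \<open>a \<bullet> b\<close> times the radial derivative of \<open>E\<close>. Both terms are
  symmetric.\<close>

lemma shess_symmetric:
  assumes p: "p \<in> \<Omega>" and v: "v \<in> tangent_plane p" and w: "w \<in> tangent_plane p"
  shows "shess f p v \<bullet> w = shess f p w \<bullet> v"
proof -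
  obtain U E where U: "open U" "p \<in> U" "\<And>k. Ck_on k E U" "\<And>q. q \<in> U \<inter> \<Omega> \<Longrightarrow> E q = f q"
    "\<And>q. q \<in> U \<inter> \<Omega> \<Longrightarrow> (f has_derivative frechet_derivative E (at q)) (at q within S2)"
    by (rule smooth_extension[OF \<Omega> f p]) (rule that)
  \<comment> \<open>The radial derivative of \<open>E\<close>, expanded so that it is visibly differentiable.\<close>
  define K where "K q = (\<Sum>b\<in>Basis. (q \<bullet> b) *\<^sub>R frechet_derivative E (at q) b)" for q
  have Kdiff: "K differentiable (at p)"
  proof -
    have "Ck_on 1 K U"
      unfolding K_def
    proof (intro Ck_on_sum Ck_on_bilinear[OF bounded_bilinear_scaleR] allI U(1) finite_Basis
        Ck_on_linear[OF bounded_linear_inner_left] Ck_on_ident)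
      show "Ck_on j (\<lambda>q. frechet_derivative E (at q) b) U" for j b
        using U(3)[of "Suc j"] by simp
    qed
    then show ?thesis using U(2) by (simp add: One_nat_def)
  qed
  have hess: "shess f p a \<bullet> b = frechet_derivative (\<lambda>q. frechet_derivative E (at q) b) (at p) a - (a \<bullet> b) * K p"
    if a: "a \<in> tangent_plane p" and b: "b \<in> tangent_plane p" for a b
  proof -
    obtain G where G: "(sgrad f has_derivative G) (at p within S2)"
        "\<And>v. v \<in> tangent_plane p \<Longrightarrow> G v = sdiff (sgrad f) p v"
      using smooth_has_derivative[OF \<Omega> smooth_sgrad p] by blast
    have lhs: "((\<lambda>q. sgrad f q \<bullet> b) has_derivative (\<lambda>v. G v \<bullet> b)) (at p within S2)"
      using G(1) by (rule has_derivative_inner_left)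
    have formula: "sgrad f q \<bullet> b = frechet_derivative E (at q) b - (b \<bullet> q) * K q" if q: "q \<in> U \<inter> \<Omega>" for q
    proof -
      have lin: "linear (frechet_derivative E (at q))"
        using U(5)[OF q] has_derivative_linear by blast
      have "sgrad f q \<bullet> b = frechet_derivative E (at q) (tangent_proj q b)"
        using sgrad_inner[of q b] sdiff_eq[OF domain_in_sphere U(5)[OF q]] q by simp
      also have "\<dots> = frechet_derivative E (at q) b - (b \<bullet> q) * frechet_derivative E (at q) q"
        by (simp add: tangent_proj_def linear_diff[OF lin] linear_cmul[OF lin])
      finally show ?thesis
        using linear_expansion[OF lin, of q] by (simp add: K_def)
    qed
    have "Ck_on 1 (\<lambda>q. frechet_derivative E (at q) b) U"
      using U(3)[of "Suc 1"] unfolding Ck_on.simps(2) by blast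
    then have "((\<lambda>q. frechet_derivative E (at q) b) has_derivative
        frechet_derivative (\<lambda>q. frechet_derivative E (at q) b) (at p)) (at p)"
      using Ck_on_SucD[of 0] U(2) unfolding One_nat_def by blast
    moreover have "(K has_derivative frechet_derivative K (at p)) (at p)"
      using Kdiff frechet_derivative_works by blast
    ultimately have "((\<lambda>q. frechet_derivative E (at q) b - (b \<bullet> q) * K q) has_derivative
        (\<lambda>a. frechet_derivative (\<lambda>q. frechet_derivative E (at q) b) (at p) a - (b \<bullet> a) * K p)) (at p)"
      using b by (auto intro!: derivative_eq_intros simp: tangent_plane_def)
    then have "((\<lambda>q. frechet_derivative E (at q) b - (b \<bullet> q) * K q) has_derivative
        (\<lambda>a. frechet_derivative (\<lambda>q. frechet_derivative E (at q) b) (at p) a - (b \<bullet> a) * K p)) (at p within S2)"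
      by (rule has_derivative_at_withinI)
    then have "((\<lambda>q. sgrad f q \<bullet> b) has_derivative
        (\<lambda>a. frechet_derivative (\<lambda>q. frechet_derivative E (at q) b) (at p) a - (b \<bullet> a) * K p)) (at p within S2)"
      by (rule has_derivative_along_sphere_cong[OF \<Omega> p U(1,2), rotated]) (simp add: formula)
    then have "G a \<bullet> b = frechet_derivative (\<lambda>q. frechet_derivative E (at q) b) (at p) a - (b \<bullet> a) * K p"
      using derivative_along_sphere_unique[OF domain_in_sphere[OF p] a lhs] by blast
    moreover have "shess f p a \<bullet> b = G a \<bullet> b"
      using G(2)[OF a] b by (simp add: shess_def tangent_proj_def tangent_plane_def inner_diff_left inner_commute[of p b])
    ultimately show ?thesis by (simp add: inner_commute)
  qed
  show ?thesis
    unfolding hess[OF v w] hess[OF w v] inner_commute[of v]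
      second_derivative_symmetric[OF U(1,2) U(3)[of 2], of w v] ..
qed

end

section \<open>Linear algebra of the tangent plane\<close>

text \<open>The columns of an orthogonal matrix with first column \<open>p\<close>.\<close>

lemma adapted_orthonormal_basis:
  assumes p: "p \<in> S2"
  obtains e1 e2 where "e1 \<in> tangent_plane p" "e2 \<in> tangent_plane p"
    "e1 \<bullet> e1 = 1" "e2 \<bullet> e2 = 1" "e1 \<bullet> e2 = 0"
    "\<And>v. v = (v \<bullet> p) *\<^sub>R p + (v \<bullet> e1) *\<^sub>R e1 + (v \<bullet> e2) *\<^sub>R e2"
proof -
  obtain Q :: "real^3^3" where Q: "orthogonal_matrix Q" "Q *v axis 1 1 = p"
    using orthogonal_matrix_exists_basis[of p 1] p by auto
  have ot: "(Q *v x) \<bullet> (Q *v y) = x \<bullet> y" for x y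
    using Q(1) orthogonal_transformation_matrix[of "(*v) Q"]
    by (simp add: orthogonal_transformation_def)
  define e where "e i = Q *v axis i 1" for i
  have ee: "e i \<bullet> e j = (if i = j then 1 else 0)" for i j
    by (simp add: e_def ot inner_axis_axis)
  have ep: "e 1 = p" using Q(2) e_def by simp
  have ex: "v = (\<Sum>i\<in>UNIV. (v \<bullet> e i) *\<^sub>R e i)" for v
  proof -
    define y where "y = transpose Q *v v"
    have v: "v = Q *v y"
      using Q(1) by (simp add: y_def matrix_vector_mul_assoc orthogonal_matrix_def
          del: vector_transpose_matrix transpose_matrix_vector)
    have "y = (\<Sum>i\<in>UNIV. (y \<bullet> axis i 1) *\<^sub>R axis i 1)"
      using basis_expansion[of y] by (simp add: inner_axis scalar_mult_eq_scaleR)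
    then have "Q *v y = (\<Sum>i\<in>UNIV. (y \<bullet> axis i 1) *\<^sub>R (Q *v axis i 1))"
      by (metis (no_types, lifting) matrix_vector_mul_linear linear_cmul linear_sum sum.cong)
    moreover have "v \<bullet> e i = y \<bullet> axis i 1" for i
      unfolding v e_def by (rule ot)
    ultimately show ?thesis
      unfolding v[symmetric] e_def[symmetric] by simp
  qed
  show ?thesis
  proof (rule that[of "e 2" "e 3"])
    show "v = (v \<bullet> p) *\<^sub>R p + (v \<bullet> e 2) *\<^sub>R e 2 + (v \<bullet> e 3) *\<^sub>R e 3" for v
    proof -
      have "(\<Sum>i\<in>UNIV. (v \<bullet> e i) *\<^sub>R e i)
          = (v \<bullet> p) *\<^sub>R p + (v \<bullet> e 2) *\<^sub>R e 2 + (v \<bullet> e 3) *\<^sub>R e 3"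
        by (simp add: sum_3 ep)
      with ex[of v] show ?thesis by (rule trans)
    qed
  qed (use ee[of 2 1] ee[of 3 1] in \<open>auto simp: ee ep tangent_plane_def\<close>)
qed

lemma trace_orthonormal_basis:
  fixes L :: "real^3 \<Rightarrow> real^3"
  assumes L: "linear L"
    and ex: "\<And>v. v = (v \<bullet> p) *\<^sub>R p + (v \<bullet> e1) *\<^sub>R e1 + (v \<bullet> e2) *\<^sub>R e2"
  shows "trace (matrix L) = L p \<bullet> p + L e1 \<bullet> e1 + L e2 \<bullet> e2"
proof -
  have "L (axis i 1) $ i = (p $ i) * (L p $ i) + (e1 $ i) * (L e1 $ i) + (e2 $ i) * (L e2 $ i)" for i
  proof -
    have "L (axis i 1) = L ((axis i 1 \<bullet> p) *\<^sub>R p + (axis i 1 \<bullet> e1) *\<^sub>R e1 + (axis i 1 \<bullet> e2) *\<^sub>R e2)"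
      using ex[of "axis i 1"] by simp
    then show ?thesis
      by (simp add: linear_add[OF L] linear_cmul[OF L] inner_axis')
  qed
  then show ?thesis
    by (simp add: trace_def matrix_def inner_vec_def sum.distrib mult.commute)
qed

lemma lorentz_add_left: "lorentz (a + b) c = lorentz a c + lorentz b c"
  and lorentz_scale_left: "lorentz (r *\<^sub>R a) c = r * lorentz a c"
  and lorentz_diff_left: "lorentz (a - b) c = lorentz a c - lorentz b c"
  and lorentz_commute: "lorentz a b = lorentz b a"
  by (auto simp: lorentz_def inner_add_left inner_diff_left algebra_simps inner_commute)

section \<open>The differential of the map\<close>

definition trace_free_hess :: "(real^3 \<Rightarrow> real) \<Rightarrow> real^3 \<Rightarrow> real^3 \<Rightarrow> real^3" where
  "trace_free_hess f p v = shess f p v - (slaplacian f p / 2) *\<^sub>R tangent_proj p v"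

text \<open>Up to sign, the coefficient of the null vector \<open>(p, 1)\<close> in the differential of \<open>Y_of f\<close> at \<open>p\<close>.\<close>

definition null_coeff :: "(real^3 \<Rightarrow> real) \<Rightarrow> real^3 \<Rightarrow> real^3 \<Rightarrow> real" where
  "null_coeff f p v = sdiff (slaplacian f) p v / 2 + sgrad f p \<bullet> v"

context
  fixes \<Omega> :: "(real^3) set" and f :: "real^3 \<Rightarrow> real"
  assumes \<Omega>: "openin (top_of_set S2) \<Omega>" and f: "smooth_on_sphere f \<Omega>"
begin

lemma sphere_point: "p \<in> \<Omega> \<Longrightarrow> p \<bullet> p = 1"
  using domain_in_sphere[OF \<Omega> f] by (simp add: dot_square_norm)

lemma smooth_Y_of: "smooth_on_sphere (Y_of f) \<Omega>"
proof -
  have split: "Y_of f = (\<lambda>p. (sgrad f p - (1/2 * slaplacian f p) *\<^sub>R p, 0) +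
      (0, - (1/2) * (slaplacian f p + 2 * f p)))"
    by (simp add: fun_eq_iff Y_of_def)
  have lin: "bounded_linear (\<lambda>x::real^3. (x, 0::real))" "bounded_linear (\<lambda>y::real. (0::real^3, y))"
    by (intro bounded_linear_Pair bounded_linear_ident bounded_linear_zero)+
  have 1: "smooth_on_sphere (\<lambda>p. sgrad f p - (1/2 * slaplacian f p) *\<^sub>R p) \<Omega>"
    by (intro smooth_on_sphere_diff smooth_sgrad[OF \<Omega> f] smooth_on_sphere_ident
        smooth_on_sphere_bilinear[OF bounded_bilinear_scaleR]
        smooth_on_sphere_linear[OF bounded_linear_mult_right] smooth_slaplacian[OF \<Omega> f])
  have 2: "smooth_on_sphere (\<lambda>p. - (1/2) * (slaplacian f p + 2 * f p)) \<Omega>"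
    by (intro smooth_on_sphere_linear[OF bounded_linear_mult_right] smooth_on_sphere_add
        smooth_slaplacian[OF \<Omega> f] f)
  show ?thesis
    unfolding split by (rule smooth_on_sphere_add[OF smooth_on_sphere_linear[OF lin(1) 1]
          smooth_on_sphere_linear[OF lin(2) 2]])
qed

lemma smooth_trace_free_hess: "smooth_on_sphere (\<lambda>p. trace_free_hess f p v) \<Omega>"
  unfolding trace_free_hess_def divide_inverse
  by (intro smooth_on_sphere_diff smooth_shess[OF \<Omega> f] smooth_on_sphere_bilinear[OF bounded_bilinear_scaleR]
      smooth_on_sphere_linear[OF bounded_linear_mult_left] smooth_slaplacian[OF \<Omega> f]
      smooth_on_sphere_tangent_proj smooth_on_sphere_const)

context
  fixes p :: "real^3"
  assumes p: "p \<in> \<Omega>"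
begin

lemma linear_trace_free_hess: "linear (trace_free_hess f p)"
  using linear_compose_sub[OF linear_shess[OF \<Omega> f p]
      linear_compose_scale_right[OF linear_tangent_proj[of p]], of "slaplacian f p / 2"]
  by (simp add: trace_free_hess_def[abs_def])

lemma trace_free_hess_tangent: "trace_free_hess f p v \<bullet> p = 0"
  using shess_tangent[OF \<Omega> f p, of v] tangent_proj_tangent[OF domain_in_sphere[OF \<Omega> f p], of v]
  by (simp add: trace_free_hess_def tangent_plane_def inner_diff_left)

lemma trace_free_hess_tangent': "p \<bullet> trace_free_hess f p v = 0"
  using trace_free_hess_tangent by (simp add: inner_commute)

lemma trace_free_hess_tangent_proj: "trace_free_hess f p (tangent_proj p v) = trace_free_hess f p v"
proof -
  have "tangent_proj p p = 0"
    by (rule tangent_proj_self[OF domain_in_sphere[OF \<Omega> f p]])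
  then have "trace_free_hess f p p = 0"
    using shess_normal[OF \<Omega> f p] by (simp add: trace_free_hess_def)
  then show ?thesis
    using linear_trace_free_hess by (simp add: tangent_proj_def linear_diff linear_cmul)
qed

lemma trace_free_hess_symmetric:
  assumes "v \<in> tangent_plane p" "w \<in> tangent_plane p"
  shows "trace_free_hess f p v \<bullet> w = trace_free_hess f p w \<bullet> v"
  using shess_symmetric[OF \<Omega> f p assms] assms
  by (simp add: trace_free_hess_def tangent_proj_ident inner_diff_left inner_commute[of v w])

lemma trace_free_hess_basis:
  obtains e1 e2 m b where "e1 \<in> tangent_plane p" "e2 \<in> tangent_plane p"
    "e1 \<bullet> e1 = 1" "e2 \<bullet> e2 = 1" "e1 \<bullet> e2 = 0"
    "\<And>v. v \<in> tangent_plane p \<Longrightarrow> v = (v \<bullet> e1) *\<^sub>R e1 + (v \<bullet> e2) *\<^sub>R e2"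
    "trace_free_hess f p e1 = m *\<^sub>R e1 + b *\<^sub>R e2" "trace_free_hess f p e2 = b *\<^sub>R e1 - m *\<^sub>R e2"
proof -
  obtain e1 e2 where e: "e1 \<in> tangent_plane p" "e2 \<in> tangent_plane p"
    "e1 \<bullet> e1 = 1" "e2 \<bullet> e2 = 1" "e1 \<bullet> e2 = 0"
    and ex: "\<And>v. v = (v \<bullet> p) *\<^sub>R p + (v \<bullet> e1) *\<^sub>R e1 + (v \<bullet> e2) *\<^sub>R e2"
    by (rule adapted_orthonormal_basis[OF domain_in_sphere[OF \<Omega> f p]]) (rule that)
  let ?A = "trace_free_hess f p"
  have ex': "v = (v \<bullet> e1) *\<^sub>R e1 + (v \<bullet> e2) *\<^sub>R e2" if "v \<bullet> p = 0" for v
    using ex[of v] unfolding that scaleR_zero_left add_0_left .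
  have "slaplacian f p = shess f p e1 \<bullet> e1 + shess f p e2 \<bullet> e2"
    unfolding slaplacian_def trace_orthonormal_basis[OF linear_shess[OF \<Omega> f p] ex]
    using shess_normal[OF \<Omega> f p] by simp
  then have tr: "?A e2 \<bullet> e2 = - (?A e1 \<bullet> e1)"
    using e by (simp add: trace_free_hess_def tangent_proj_ident inner_diff_left field_simps)
  have sym: "?A e2 \<bullet> e1 = ?A e1 \<bullet> e2"
    using trace_free_hess_symmetric[OF e(2,1)] .
  show ?thesis
  proof (rule that[OF e])
    show "v = (v \<bullet> e1) *\<^sub>R e1 + (v \<bullet> e2) *\<^sub>R e2" if "v \<in> tangent_plane p" for v
      using ex' that by (simp add: tangent_plane_def)
    show "?A e1 = (?A e1 \<bullet> e1) *\<^sub>R e1 + (?A e1 \<bullet> e2) *\<^sub>R e2"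
      by (rule ex'[OF trace_free_hess_tangent])
    show "?A e2 = (?A e1 \<bullet> e2) *\<^sub>R e1 - (?A e1 \<bullet> e1) *\<^sub>R e2"
      using ex'[OF trace_free_hess_tangent, of e2] unfolding tr sym by simp
  qed
qed

text \<open>In the basis above the matrix of \<open>A\<close> has rows \<open>(m, b)\<close> and \<open>(b, -m)\<close>, and its square is
  \<open>m\<^sup>2 + b\<^sup>2\<close> times the identity.\<close>

lemma trace_free_hess_conformal:
  obtains \<mu> where "\<And>v w. \<lbrakk>v \<in> tangent_plane p; w \<in> tangent_plane p\<rbrakk> \<Longrightarrow>
    trace_free_hess f p v \<bullet> trace_free_hess f p w = \<mu> * (v \<bullet> w)"
    "\<mu> \<ge> 0"
proof -
  obtain e1 e2 m b where e: "e1 \<bullet> e1 = 1" "e2 \<bullet> e2 = 1" "e1 \<bullet> e2 = 0"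
    and ex: "\<And>v. v \<in> tangent_plane p \<Longrightarrow> v = (v \<bullet> e1) *\<^sub>R e1 + (v \<bullet> e2) *\<^sub>R e2"
    and A: "trace_free_hess f p e1 = m *\<^sub>R e1 + b *\<^sub>R e2" "trace_free_hess f p e2 = b *\<^sub>R e1 - m *\<^sub>R e2"
    by (rule trace_free_hess_basis) (rule that)
  have e21: "e2 \<bullet> e1 = 0" using e(3) by (simp add: inner_commute)
  have main: "trace_free_hess f p (x *\<^sub>R e1 + y *\<^sub>R e2) \<bullet> trace_free_hess f p (z *\<^sub>R e1 + w *\<^sub>R e2)
      = (m\<^sup>2 + b\<^sup>2) * ((x *\<^sub>R e1 + y *\<^sub>R e2) \<bullet> (z *\<^sub>R e1 + w *\<^sub>R e2))" for x y z w
    by (simp add: linear_add[OF linear_trace_free_hess] linear_cmul[OF linear_trace_free_hess] A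
        inner_add_left inner_add_right inner_diff_left inner_diff_right e e21
        algebra_simps power2_eq_square)
  show ?thesis
  proof (rule that[of "m\<^sup>2 + b\<^sup>2"])
    show "trace_free_hess f p v \<bullet> trace_free_hess f p w = (m\<^sup>2 + b\<^sup>2) * (v \<bullet> w)"
      if "v \<in> tangent_plane p" "w \<in> tangent_plane p" for v w
      using main[of "v \<bullet> e1" "v \<bullet> e2" "w \<bullet> e1" "w \<bullet> e2"]
      unfolding ex[OF that(1), symmetric] ex[OF that(2), symmetric] .
  qed simp
qed

text \<open>Two orthogonal tangent vectors of equal length compute, up to the squared length, the trace of \<open>A\<close>.
  Stated for unnormalized vectors so that it applies to frames that are orthonormal for the induced
  metric.\<close>

lemma trace_free_hess_trace:
  assumes v: "v \<in> tangent_plane p" and w: "w \<in> tangent_plane p"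
    and vw: "v \<bullet> v = w \<bullet> w" "v \<bullet> w = 0"
  shows "trace_free_hess f p v \<bullet> v + trace_free_hess f p w \<bullet> w = 0"
proof -
  obtain e1 e2 m b where e: "e1 \<bullet> e1 = 1" "e2 \<bullet> e2 = 1" "e1 \<bullet> e2 = 0"
    and ex: "\<And>v. v \<in> tangent_plane p \<Longrightarrow> v = (v \<bullet> e1) *\<^sub>R e1 + (v \<bullet> e2) *\<^sub>R e2"
    and A: "trace_free_hess f p e1 = m *\<^sub>R e1 + b *\<^sub>R e2" "trace_free_hess f p e2 = b *\<^sub>R e1 - m *\<^sub>R e2"
    by (rule trace_free_hess_basis) (rule that)
  have e21: "e2 \<bullet> e1 = 0" using e(3) by (simp add: inner_commute)
  obtain x y z t where v': "v = x *\<^sub>R e1 + y *\<^sub>R e2" and w': "w = z *\<^sub>R e1 + t *\<^sub>R e2"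
    using ex[OF v] ex[OF w] by blast
  have n: "x * x + y * y = z * z + t * t" and o: "x * z + y * t = 0"
    using vw by (simp_all add: v' w' inner_add_left inner_add_right e e21 mult.commute)
  have q: "trace_free_hess f p (x *\<^sub>R e1 + y *\<^sub>R e2) \<bullet> (x *\<^sub>R e1 + y *\<^sub>R e2)
      = m * (x * x - y * y) + 2 * b * (x * y)" for x y
    by (simp add: linear_add[OF linear_trace_free_hess] linear_cmul[OF linear_trace_free_hess] A
        inner_add_left inner_add_right inner_diff_left inner_diff_right e e21 algebra_simps)
  \<comment> \<open>The second vector is the first one turned by a right angle, up to sign.\<close>
  have zt: "z * z = y * y \<and> t * t = x * x \<and> z * t = - (x * y)"
  proof (cases "x * x + y * y = 0")
    case True
    then have "x = 0" "y = 0" by (simp_all add: sum_squares_eq_zero_iff)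
    moreover have "z = 0" "t = 0"
      using n True by (simp_all add: sum_squares_eq_zero_iff)
    ultimately show ?thesis by simp
  next
    case False
    define k where "k = (x * t - y * z) / (x * x + y * y)"
    have k: "k * (x * x + y * y) = x * t - y * z"
      using False by (simp add: k_def)
    have "(z + k * y) * (x * x + y * y) = 0" "(t - k * x) * (x * x + y * y) = 0"
      using k o by algebra+
    then have "z + k * y = 0" "t - k * x = 0"
      using False mult_eq_0_iff by blast+
    then have z: "z = - k * y" and t: "t = k * x"
      by simp_all
    have "(k * k - 1) * (x * x + y * y) = 0"
      using n unfolding z t by algebra
    then have "k * k - 1 = 0" using False mult_eq_0_iff by blast
    then have "k * k = 1" by simp
    then show ?thesis unfolding z t by algebra
  qed
  show ?thesis unfolding v' w' q using zt by algebra
qed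

text \<open>The derivative of \<open>sgrad f\<close> has the normal component \<open>- (sgrad f p \<bullet> v)\<close>, because the gradient is
  orthogonal to the position vector. This component combines with the derivative of the Laplacian into
  a multiple of \<open>p\<close> that equals the last coordinate, and this makes the remainder null.\<close>

lemma sdiff_Y_of:
  assumes v: "v \<in> tangent_plane p"
  shows "sdiff (Y_of f) p v = (trace_free_hess f p v - null_coeff f p v *\<^sub>R p, - null_coeff f p v)"
proof -
  obtain G where G: "(sgrad f has_derivative G) (at p within S2)"
      "\<And>v. v \<in> tangent_plane p \<Longrightarrow> G v = sdiff (sgrad f) p v"
    by (rule smooth_has_derivative[OF \<Omega> smooth_sgrad[OF \<Omega> f] p]) (rule that)
  obtain L where L: "(slaplacian f has_derivative L) (at p within S2)"
      "\<And>v. v \<in> tangent_plane p \<Longrightarrow> L v = sdiff (slaplacian f) p v"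
    by (rule smooth_has_derivative[OF \<Omega> smooth_slaplacian[OF \<Omega> f] p]) (rule that)
  obtain D where D: "(f has_derivative D) (at p within S2)"
      "\<And>v. v \<in> tangent_plane p \<Longrightarrow> D v = sdiff f p v"
    by (rule smooth_has_derivative[OF \<Omega> f p]) (rule that)
  have pS: "p \<in> S2" using domain_in_sphere[OF \<Omega> f p] .
  have "((\<lambda>q. sgrad f q \<bullet> q) has_derivative (\<lambda>v. sgrad f p \<bullet> v + G v \<bullet> p)) (at p within S2)"
    using G(1) by (auto intro!: derivative_eq_intros)
  moreover have "((\<lambda>q. sgrad f q \<bullet> q) has_derivative (\<lambda>v. 0)) (at p within S2)"
    by (rule has_derivative_along_sphere_cong[OF \<Omega> p open_UNIV UNIV_I _ has_derivative_const])
      (simp add: sgrad_normal[OF \<Omega> f])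
  ultimately have normal: "sgrad f p \<bullet> v + G v \<bullet> p = 0"
    by (rule derivative_along_sphere_unique[OF pS v])
  have "(Y_of f has_derivative (\<lambda>v. (G v - ((1/2 * slaplacian f p) *\<^sub>R v + (1/2 * L v) *\<^sub>R p),
      - (1/2) * (L v + 2 * D v)))) (at p within S2)"
    unfolding Y_of_def[abs_def]
    by (intro has_derivative_Pair has_derivative_diff has_derivative_scaleR has_derivative_mult_right
        has_derivative_add has_derivative_ident G(1) L(1) D(1))
  from sdiff_eq[OF pS this, of v]
  have "sdiff (Y_of f) p v = (G v - ((1/2 * slaplacian f p) *\<^sub>R v + (1/2 * L v) *\<^sub>R p),
      - (1/2) * (L v + 2 * D v))"
    unfolding tangent_proj_ident[OF v] .
  moreover have "G v = shess f p v - (sgrad f p \<bullet> v) *\<^sub>R p"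
  proof -
    have "shess f p v = G v - (G v \<bullet> p) *\<^sub>R p"
      using G(2)[OF v] by (simp add: shess_def tangent_proj_def)
    moreover have "G v \<bullet> p = - (sgrad f p \<bullet> v)" using normal by simp
    ultimately show ?thesis by simp
  qed
  ultimately show ?thesis
    using L(2)[OF v] D(2)[OF v] tangent_proj_ident[OF v] sgrad_inner[OF \<Omega> f p, of v]
    by (simp add: trace_free_hess_def null_coeff_def algebra_simps add_divide_distrib)
qed

lemma linear_sdiff_Y_of: "linear (sdiff (Y_of f) p)"
  using linear_sdiff smooth_differentiable[OF \<Omega> smooth_Y_of p] by blast

lemma lorentz_sdiff_Y_of:
  assumes "v \<in> tangent_plane p" "w \<in> tangent_plane p"
  shows "lorentz (sdiff (Y_of f) p v) (sdiff (Y_of f) p w) =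
    trace_free_hess f p v \<bullet> trace_free_hess f p w"
  by (simp add: sdiff_Y_of assms lorentz_def inner_diff_left inner_diff_right sphere_point[OF p]
      trace_free_hess_tangent trace_free_hess_tangent')

lemma null_normal: "(p, 1) \<in> normal_plane (Y_of f) p"
  by (simp add: normal_plane_def sdiff_Y_of lorentz_def inner_diff_right sphere_point[OF p]
      trace_free_hess_tangent')

lemma null_normal_sdiff: "lorentz (sdiff (Y_of f) p v) (p, 1) = 0"
proof -
  have pS: "p \<in> S2" by (rule domain_in_sphere[OF \<Omega> f p])
  have "lorentz (p, 1) (sdiff (Y_of f) p (tangent_proj p v)) = 0"
    using null_normal tangent_proj_tangent[OF pS, of v] unfolding normal_plane_def by blast
  then show ?thesis
    unfolding sdiff_tangent_proj[OF pS] lorentz_commute[of "(p, 1)"] .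
qed

lemma trace_free_hess_conformal_factor:
  assumes "trace_free_hess f p u \<noteq> 0"
  obtains \<mu> where "\<mu> > 0"
    "\<And>v w. \<lbrakk>v \<in> tangent_plane p; w \<in> tangent_plane p\<rbrakk> \<Longrightarrow>
      trace_free_hess f p v \<bullet> trace_free_hess f p w = \<mu> * (v \<bullet> w)"
proof -
  obtain \<mu> where \<mu>: "\<And>v w. \<lbrakk>v \<in> tangent_plane p; w \<in> tangent_plane p\<rbrakk> \<Longrightarrow>
      trace_free_hess f p v \<bullet> trace_free_hess f p w = \<mu> * (v \<bullet> w)" "\<mu> \<ge> 0"
    by (rule trace_free_hess_conformal) (rule that)
  have t: "tangent_proj p u \<in> tangent_plane p"
    by (rule tangent_proj_tangent[OF domain_in_sphere[OF \<Omega> f p]])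
  have "\<mu> \<noteq> 0"
    using \<mu>(1)[OF t t] assms trace_free_hess_tangent_proj by auto
  then have "\<mu> > 0" using \<mu>(2) by simp
  then show ?thesis using that \<mu>(1) by blast
qed

text \<open>If the trace-free Hessian vanishes, the differential of \<open>Y_of f\<close> maps the tangent plane into the line
  spanned by \<open>(p, 1)\<close>, so some nonzero combination of two basis vectors lies in its kernel.\<close>

lemma immersed_iff:
  "inj_on (sdiff (Y_of f) p) (tangent_plane p) \<longleftrightarrow> (\<exists>u. trace_free_hess f p u \<noteq> 0)"
proof
  assume "\<exists>u. trace_free_hess f p u \<noteq> 0"
  then obtain u where "trace_free_hess f p u \<noteq> 0" ..
  then obtain \<mu> where \<mu>: "\<mu> > 0"
    "\<And>v w. \<lbrakk>v \<in> tangent_plane p; w \<in> tangent_plane p\<rbrakk> \<Longrightarrow>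
      trace_free_hess f p v \<bullet> trace_free_hess f p w = \<mu> * (v \<bullet> w)"
    by (rule trace_free_hess_conformal_factor) (rule that)
  show "inj_on (sdiff (Y_of f) p) (tangent_plane p)"
  proof (rule inj_onI)
    fix v w assume vw: "v \<in> tangent_plane p" "w \<in> tangent_plane p"
      "sdiff (Y_of f) p v = sdiff (Y_of f) p w"
    have d: "v - w \<in> tangent_plane p"
      using vw by (simp add: tangent_plane_def inner_diff_left)
    have "trace_free_hess f p v = trace_free_hess f p w"
      using vw(3) unfolding sdiff_Y_of[OF vw(1)] sdiff_Y_of[OF vw(2)] by auto
    then have "trace_free_hess f p (v - w) = 0"
      by (simp add: linear_diff[OF linear_trace_free_hess])
    then show "v = w" using \<mu>(2)[OF d d] \<mu>(1) by simp
  qed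
next
  assume inj: "inj_on (sdiff (Y_of f) p) (tangent_plane p)"
  show "\<exists>u. trace_free_hess f p u \<noteq> 0"
  proof (rule ccontr)
    assume "\<not> ?thesis"
    then have A: "trace_free_hess f p u = 0" for u by blast
    obtain e1 e2 where e: "e1 \<in> tangent_plane p" "e2 \<in> tangent_plane p"
        "e1 \<bullet> e1 = 1" "e2 \<bullet> e2 = 1" "e1 \<bullet> e2 = 0"
      by (rule trace_free_hess_basis) (rule that)
    let ?d = "sdiff (Y_of f) p"
    have zero: "v = 0" if "v \<in> tangent_plane p" "?d v = 0" for v
      using inj_onD[OF inj, of v 0] that linear_0[OF linear_sdiff_Y_of] by (simp add: tangent_plane_def)
    have d: "?d v = - null_coeff f p v *\<^sub>R (p, 1)" if "v \<in> tangent_plane p" for v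
      unfolding sdiff_Y_of[OF that] A by simp
    let ?v = "null_coeff f p e2 *\<^sub>R e1 - null_coeff f p e1 *\<^sub>R e2"
    have "?v \<in> tangent_plane p"
      using e by (simp add: tangent_plane_def inner_diff_left)
    moreover have "?d ?v = 0"
      unfolding linear_diff[OF linear_sdiff_Y_of] linear_cmul[OF linear_sdiff_Y_of] d[OF e(1)] d[OF e(2)]
      by (simp add: mult.commute)
    ultimately have "?v \<bullet> e2 = 0" using zero by fastforce
    then have "null_coeff f p e1 = 0" using e by (simp add: inner_diff_left)
    then have "e1 = 0" using zero[OF e(1)] d[OF e(1)] by (simp add: zero_prod_def)
    then show False using e(3) by simp
  qed
qed

end

text \<open>The function pairing \<open>sdiff (Y_of f) q v\<close> with \<open>(q, 1)\<close> vanishes identically in \<open>q\<close>. Its derivative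
  along \<open>u\<close> is the left-hand side plus the pairing of \<open>sdiff (Y_of f) p v\<close> with \<open>(u, 0)\<close>.\<close>

lemma second_derivative_null:
  assumes p: "p \<in> \<Omega>" and u: "u \<in> tangent_plane p" and v: "v \<in> tangent_plane p"
  shows "lorentz (sdiff (\<lambda>q. sdiff (Y_of f) q v) p u) (p, 1) = - (trace_free_hess f p v \<bullet> u)"
proof -
  let ?\<Phi> = "\<lambda>q. sdiff (Y_of f) q v"
  obtain D where D: "(?\<Phi> has_derivative D) (at p within S2)"
      "\<And>v. v \<in> tangent_plane p \<Longrightarrow> D v = sdiff ?\<Phi> p v"
    by (rule smooth_has_derivative[OF \<Omega> smooth_on_sphere_sdiff[OF \<Omega> smooth_Y_of] p]) (rule that)
  have pS: "p \<in> S2" using domain_in_sphere[OF \<Omega> f p] .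
  have "((\<lambda>q. fst (?\<Phi> q) \<bullet> q - snd (?\<Phi> q)) has_derivative
      (\<lambda>u. fst (?\<Phi> p) \<bullet> u + fst (D u) \<bullet> p - snd (D u))) (at p within S2)"
    by (intro has_derivative_diff has_derivative_inner has_derivative_ident
        has_derivative_fst has_derivative_snd D(1))
  then have "fst (?\<Phi> p) \<bullet> u + fst (D u) \<bullet> p - snd (D u) = 0"
  proof (rule derivative_along_sphere_unique[OF pS u])
    show "((\<lambda>q. fst (?\<Phi> q) \<bullet> q - snd (?\<Phi> q)) has_derivative (\<lambda>v. 0)) (at p within S2)"
      by (rule has_derivative_along_sphere_cong[OF \<Omega> p open_UNIV UNIV_I _ has_derivative_const])
        (use null_normal_sdiff in \<open>simp add: lorentz_def\<close>)
  qed
  moreover have "fst (?\<Phi> p) \<bullet> u = trace_free_hess f p v \<bullet> u"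
    using u by (simp add: sdiff_Y_of[OF p v] inner_diff_left tangent_plane_def inner_commute[of p u])
  ultimately show ?thesis
    unfolding D(2)[OF u] lorentz_def by simp
qed

end

section \<open>The mean curvature vector\<close>

context
  fixes \<Omega> :: "(real^3) set" and f :: "real^3 \<Rightarrow> real" and p :: "real^3"
  assumes \<Omega>: "openin (top_of_set S2) \<Omega>" and f: "smooth_on_sphere f \<Omega>"
    and p: "p \<in> immersed_part \<Omega> (Y_of f)"
begin

lemma in_domain: "p \<in> \<Omega>"
  using p by (simp add: immersed_part_def)

lemma sdiff_Y_of_conformal:
  obtains \<mu> where "\<mu> > 0"
    "\<And>v w. \<lbrakk>v \<in> tangent_plane p; w \<in> tangent_plane p\<rbrakk> \<Longrightarrow>
      lorentz (sdiff (Y_of f) p v) (sdiff (Y_of f) p w) = \<mu> * (v \<bullet> w)"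
proof -
  obtain u where "trace_free_hess f p u \<noteq> 0"
    using p immersed_iff[OF \<Omega> f in_domain] by (auto simp: immersed_part_def)
  then obtain \<mu> where "\<mu> > 0"
    "\<And>v w. \<lbrakk>v \<in> tangent_plane p; w \<in> tangent_plane p\<rbrakk> \<Longrightarrow>
      trace_free_hess f p v \<bullet> trace_free_hess f p w = \<mu> * (v \<bullet> w)"
    by (rule trace_free_hess_conformal_factor[OF \<Omega> f in_domain]) (rule that)
  then show ?thesis
    using that[of \<mu>] lorentz_sdiff_Y_of[OF \<Omega> f in_domain] by simp
qed

text \<open>The Lorentz product is positive definite on the image of the differential, so orthogonal projection
  to that image exists and is unique, although the ambient product is indefinite.\<close>

lemma normal_part_Y_of:
  "normal_part (Y_of f) p w \<in> normal_plane (Y_of f) p \<and>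
   w - normal_part (Y_of f) p w \<in> sdiff (Y_of f) p ` tangent_plane p"
proof -
  let ?d = "sdiff (Y_of f) p"
  obtain \<mu> where \<mu>: "\<mu> > 0"
    "\<And>v w. \<lbrakk>v \<in> tangent_plane p; w \<in> tangent_plane p\<rbrakk> \<Longrightarrow> lorentz (?d v) (?d w) = \<mu> * (v \<bullet> w)"
    by (rule sdiff_Y_of_conformal) (rule that)
  obtain e1 e2 where e: "e1 \<in> tangent_plane p" "e2 \<in> tangent_plane p"
    and ex: "\<And>v. v \<in> tangent_plane p \<Longrightarrow> v = (v \<bullet> e1) *\<^sub>R e1 + (v \<bullet> e2) *\<^sub>R e2"
    by (rule trace_free_hess_basis[OF \<Omega> f in_domain]) (rule that)
  have lin: "linear ?d" by (rule linear_sdiff_Y_of[OF \<Omega> f in_domain])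
  \<comment> \<open>The image of \<open>u\<close> is the orthogonal projection of \<open>w\<close>: \<open>e1\<close>, \<open>e2\<close> are mapped to orthogonal
    vectors of squared length \<open>\<mu>\<close>.\<close>
  define u where "u = (lorentz w (?d e1) / \<mu>) *\<^sub>R e1 + (lorentz w (?d e2) / \<mu>) *\<^sub>R e2"
  have u: "u \<in> tangent_plane p"
    using e by (simp add: u_def tangent_plane_def inner_add_left)
  have "lorentz (w - ?d u) (?d v) = 0" if v: "v \<in> tangent_plane p" for v
  proof -
    have "lorentz w (?d v) = lorentz w (?d ((v \<bullet> e1) *\<^sub>R e1 + (v \<bullet> e2) *\<^sub>R e2))"
      by (rule arg_cong[OF ex[OF v]])
    also have "\<dots> = (v \<bullet> e1) * lorentz w (?d e1) + (v \<bullet> e2) * lorentz w (?d e2)"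
      by (simp add: linear_add[OF lin] linear_cmul[OF lin] lorentz_commute[of w]
          lorentz_add_left lorentz_scale_left)
    also have "\<dots> = \<mu> * (u \<bullet> v)"
      using \<mu>(1) by (simp add: u_def inner_add_left inner_commute[of v] distrib_left)
    also have "\<dots> = lorentz (?d u) (?d v)"
      using \<mu>(2)[OF u v] by simp
    finally show ?thesis by (simp add: lorentz_diff_left)
  qed
  then have ex1: "w - ?d u \<in> normal_plane (Y_of f) p" "w - (w - ?d u) \<in> ?d ` tangent_plane p"
    using u by (auto simp: normal_plane_def)
  have "n = w - ?d u"
    if n: "n \<in> normal_plane (Y_of f) p" "w - n \<in> ?d ` tangent_plane p" for n
  proof -
    obtain z where z: "z \<in> tangent_plane p" "w - n = ?d z" using n(2) by blast
    have zu: "z - u \<in> tangent_plane p"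
      using z(1) u by (simp add: tangent_plane_def inner_diff_left)
    have diff: "?d (z - u) = (w - ?d u) - n"
      using z(2) by (simp add: linear_diff[OF lin] algebra_simps)
    have "lorentz (?d (z - u)) (?d (z - u)) = 0"
      using n(1) ex1(1) zu unfolding normal_plane_def
      by (subst diff) (simp add: lorentz_diff_left)
    then have "z - u = 0"
      using \<mu>(2)[OF zu zu] \<mu>(1) by simp
    then show ?thesis using z(2) by (simp add: algebra_simps)
  qed
  then have "\<exists>!n. n \<in> normal_plane (Y_of f) p \<and> w - n \<in> ?d ` tangent_plane p"
    using ex1 by blast
  then show ?thesis
    unfolding normal_part_def by (rule theI')
qed

lemma second_fundamental_form_null:
  assumes u: "u \<in> tangent_plane p" and v: "v \<in> tangent_plane p"
  shows "lorentz (second_fundamental_form (Y_of f) p u v) (p, 1) = - (trace_free_hess f p v \<bullet> u)"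
proof -
  let ?w = "sdiff (\<lambda>q. sdiff (Y_of f) q v) p u"
  obtain z where "?w - normal_part (Y_of f) p ?w = sdiff (Y_of f) p z"
    using normal_part_Y_of[of ?w] by blast
  then have "lorentz (?w - normal_part (Y_of f) p ?w) (p, 1) = 0"
    using null_normal_sdiff[OF \<Omega> f in_domain] by simp
  then show ?thesis
    using second_derivative_null[OF \<Omega> f in_domain u v]
    by (simp add: second_fundamental_form_def lorentz_diff_left)
qed

text \<open>The mean curvature vector is computed in an unspecified frame, so that a frame has to be exhibited
  first; rescaling a Euclidean orthonormal basis by \<open>1 / sqrt \<mu>\<close> gives one. In any frame the component
  along \<open>(p, 1)\<close> is half the negative of a trace of \<open>A\<close>.\<close>

lemma mean_curvature_vector_Y_of:
  "mean_curvature_vector (Y_of f) p \<in> normal_plane (Y_of f) p"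
  "lorentz (mean_curvature_vector (Y_of f) p) (p, 1) = 0"
proof -
  let ?Y = "Y_of f"
  let ?H = "mean_curvature_vector ?Y p"
  obtain \<mu> where \<mu>: "\<mu> > 0"
    "\<And>v w. \<lbrakk>v \<in> tangent_plane p; w \<in> tangent_plane p\<rbrakk> \<Longrightarrow>
      lorentz (sdiff ?Y p v) (sdiff ?Y p w) = \<mu> * (v \<bullet> w)"
    by (rule sdiff_Y_of_conformal) (rule that)
  obtain e1 e2 where e: "e1 \<in> tangent_plane p" "e2 \<in> tangent_plane p"
      "e1 \<bullet> e1 = 1" "e2 \<bullet> e2 = 1" "e1 \<bullet> e2 = 0"
    by (rule trace_free_hess_basis[OF \<Omega> f in_domain]) (rule that)
  have t: "r *\<^sub>R e \<in> tangent_plane p" if "e \<in> tangent_plane p" for r e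
    using that by (simp add: tangent_plane_def)
  have "orthonormal_frame ?Y p ((1 / sqrt \<mu>) *\<^sub>R e1) ((1 / sqrt \<mu>) *\<^sub>R e2)"
    using \<mu> e t by (simp add: orthonormal_frame_def)
  then obtain u v where frame: "orthonormal_frame ?Y p u v"
    and H: "?H = (1/2) *\<^sub>R (second_fundamental_form ?Y p u u + second_fundamental_form ?Y p v v)"
    unfolding mean_curvature_vector_def
    using someI_ex[of "\<lambda>H. \<exists>e1 e2. orthonormal_frame ?Y p e1 e2 \<and>
      H = (1/2) *\<^sub>R (second_fundamental_form ?Y p e1 e1 + second_fundamental_form ?Y p e2 e2)"]
    by blast
  show "?H \<in> normal_plane ?Y p"
    using normal_part_Y_of unfolding H second_fundamental_form_def normal_plane_def
    by (simp add: lorentz_scale_left lorentz_add_left)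
  have uv: "u \<in> tangent_plane p" "v \<in> tangent_plane p"
    using frame by (simp_all add: orthonormal_frame_def)
  have "\<mu> * (u \<bullet> u) = \<mu> * (v \<bullet> v)" "\<mu> * (u \<bullet> v) = 0"
    using frame \<mu>(2)[OF uv(1) uv(1)] \<mu>(2)[OF uv(2) uv(2)] \<mu>(2)[OF uv]
    by (simp_all add: orthonormal_frame_def)
  then have "u \<bullet> u = v \<bullet> v" "u \<bullet> v = 0"
    using \<mu>(1) by simp_all
  then have "trace_free_hess f p u \<bullet> u + trace_free_hess f p v \<bullet> v = 0"
    by (rule trace_free_hess_trace[OF \<Omega> f in_domain uv])
  then show "lorentz ?H (p, 1) = 0"
    unfolding H lorentz_scale_left lorentz_add_left second_fundamental_form_null[OF uv(1) uv(1)]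
      second_fundamental_form_null[OF uv(2) uv(2)] by simp
qed

text \<open>A normal vector \<open>(h, t)\<close> that is orthogonal to \<open>(p, 1)\<close> satisfies \<open>h \<bullet> p = t\<close> and \<open>A v \<bullet> h = 0\<close>
  for all tangent \<open>v\<close>. As \<open>A\<close> is symmetric and injective on the tangent plane, the tangential part of
  \<open>h\<close> vanishes, which leaves \<open>(h, t) = t (p, 1)\<close>.\<close>

lemma mean_curvature_vector_null:
  "lorentz (mean_curvature_vector (Y_of f) p) (mean_curvature_vector (Y_of f) p) = 0"
proof -
  let ?H = "mean_curvature_vector (Y_of f) p"
  obtain h t where H: "?H = (h, t)" by fastforce
  have pp: "p \<bullet> p = 1" by (rule sphere_point[OF \<Omega> f in_domain])
  have ht: "h \<bullet> p = t"
    using mean_curvature_vector_Y_of(2) by (simp add: H lorentz_def)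
  obtain u where "trace_free_hess f p u \<noteq> 0"
    using p immersed_iff[OF \<Omega> f in_domain] by (auto simp: immersed_part_def)
  then obtain \<mu> where \<mu>: "\<mu> > 0"
    "\<And>v w. \<lbrakk>v \<in> tangent_plane p; w \<in> tangent_plane p\<rbrakk> \<Longrightarrow>
      trace_free_hess f p v \<bullet> trace_free_hess f p w = \<mu> * (v \<bullet> w)"
    by (rule trace_free_hess_conformal_factor[OF \<Omega> f in_domain]) (rule that)
  let ?A = "trace_free_hess f p"
  define k where "k = h - t *\<^sub>R p"
  have k: "k \<in> tangent_plane p"
    using ht pp by (simp add: k_def tangent_plane_def inner_diff_left)
  have A0: "?A v \<bullet> k = 0" if v: "v \<in> tangent_plane p" for v
    using mean_curvature_vector_Y_of(1) v ht trace_free_hess_tangent[OF \<Omega> f in_domain, of v]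
    by (auto simp: normal_plane_def H lorentz_def sdiff_Y_of[OF \<Omega> f in_domain] k_def
        inner_diff_right inner_commute)
  have At: "?A v \<in> tangent_plane p" for v
    using trace_free_hess_tangent[OF \<Omega> f in_domain] by (simp add: tangent_plane_def)
  have "?A k \<bullet> ?A k = 0"
    using trace_free_hess_symmetric[OF \<Omega> f in_domain k At[of k]] A0[OF At] by simp
  then have "k = 0"
    using \<mu>(2)[OF k k] \<mu>(1) by simp
  then have "?H = (t *\<^sub>R p, t)"
    by (simp add: H k_def)
  then show ?thesis
    using pp by (simp add: lorentz_def)
qed

end

section \<open>The marginally trapped surface and its boundary values\<close>

lemma openin_immersed_part:
  assumes \<Omega>: "openin (top_of_set S2) \<Omega>" and f: "smooth_on_sphere f \<Omega>"
  shows "openin (top_of_set S2) (immersed_part \<Omega> (Y_of f))"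
proof -
  have "immersed_part \<Omega> (Y_of f) = (\<Union>v. \<Omega> \<inter> (\<lambda>p. trace_free_hess f p v) -` (- {0}))"
    using immersed_iff[OF \<Omega> f] by (auto simp: immersed_part_def)
  moreover have "openin (top_of_set \<Omega>) (\<Omega> \<inter> (\<lambda>p. trace_free_hess f p v) -` (- {0}))" for v
    by (rule continuous_openin_preimage_gen[OF smooth_continuous[OF \<Omega> smooth_trace_free_hess[OF \<Omega> f]]])
      auto
  ultimately show ?thesis
    by (auto simp del: UN_simps intro!: openin_Union openin_trans[OF _ \<Omega>])
qed

lemma spacelike_surface_Y_of:
  assumes \<Omega>: "openin (top_of_set S2) \<Omega>" and f: "smooth_on_sphere f \<Omega>"
  shows "spacelike_surface (immersed_part \<Omega> (Y_of f)) (Y_of f)"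
  unfolding spacelike_surface_def
proof (intro conjI ballI impI)
  show "openin (top_of_set S2) (immersed_part \<Omega> (Y_of f))"
    by (rule openin_immersed_part[OF \<Omega> f])
  show "smooth_on_sphere (Y_of f) (immersed_part \<Omega> (Y_of f))"
    using smooth_on_sphere_subset[OF smooth_Y_of[OF \<Omega> f]] by (auto simp: immersed_part_def)
next
  fix p v assume p: "p \<in> immersed_part \<Omega> (Y_of f)" and v: "v \<in> tangent_plane p" "v \<noteq> 0"
  obtain \<mu> where \<mu>: "\<mu> > 0"
    "\<And>v w. \<lbrakk>v \<in> tangent_plane p; w \<in> tangent_plane p\<rbrakk> \<Longrightarrow>
      lorentz (sdiff (Y_of f) p v) (sdiff (Y_of f) p w) = \<mu> * (v \<bullet> w)"
    by (rule sdiff_Y_of_conformal[OF \<Omega> f p]) (rule that)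
  show "lorentz (sdiff (Y_of f) p v) (sdiff (Y_of f) p v) > 0"
    using \<mu>(2)[OF v(1) v(1)] \<mu>(1) v(2) by simp
qed

lemma agree_on_boundary_Pair:
  assumes "agree_on_boundary \<Omega> F G" "agree_on_boundary \<Omega> F' G'"
  shows "agree_on_boundary \<Omega> (\<lambda>x. (F x, F' x)) (\<lambda>x. (G x, G' x))"
  unfolding agree_on_boundary_def
proof
  fix p assume p: "p \<in> sphere_boundary \<Omega>"
  obtain L where L: "(F \<longlongrightarrow> L) (at p within \<Omega>)" "(G \<longlongrightarrow> L) (at p within \<Omega>)"
    using bspec[OF assms(1)[unfolded agree_on_boundary_def] p] by (elim exE conjE)
  obtain L' where L': "(F' \<longlongrightarrow> L') (at p within \<Omega>)" "(G' \<longlongrightarrow> L') (at p within \<Omega>)"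
    using bspec[OF assms(2)[unfolded agree_on_boundary_def] p] by (elim exE conjE)
  show "\<exists>L. ((\<lambda>x. (F x, F' x)) \<longlongrightarrow> L) (at p within \<Omega>) \<and> ((\<lambda>x. (G x, G' x)) \<longlongrightarrow> L) (at p within \<Omega>)"
    by (intro exI[of _ "(L, L')"] conjI tendsto_Pair L L')
qed

lemma agree_on_boundary_continuous:
  fixes h :: "(real^3) \<times> 'a::t2_space \<Rightarrow> 'b::t2_space"
  assumes "agree_on_boundary \<Omega> F G" "continuous_on UNIV h"
  shows "agree_on_boundary \<Omega> (\<lambda>x. h (x, F x)) (\<lambda>x. h (x, G x))"
proof -
  have c: "isCont h y" for y
    using assms(2) continuous_on_eq_continuous_at by blast
  have "((\<lambda>x. h (x, K x)) \<longlongrightarrow> h (p, L)) (at p within \<Omega>)"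
    if "(K \<longlongrightarrow> L) (at p within \<Omega>)" for p K L
    using isCont_tendsto_compose[OF c tendsto_Pair[OF tendsto_ident_at that]] by simp
  note lim = this
  show ?thesis
    unfolding agree_on_boundary_def
  proof
    fix p assume p: "p \<in> sphere_boundary \<Omega>"
    obtain L where L: "(F \<longlongrightarrow> L) (at p within \<Omega>)" "(G \<longlongrightarrow> L) (at p within \<Omega>)"
      using bspec[OF assms(1)[unfolded agree_on_boundary_def] p] by (elim exE conjE)
    show "\<exists>L. ((\<lambda>x. h (x, F x)) \<longlongrightarrow> L) (at p within \<Omega>) \<and> ((\<lambda>x. h (x, G x)) \<longlongrightarrow> L) (at p within \<Omega>)"
      by (intro exI[of _ "h (p, L)"] conjI lim L)
  qed
qed

text \<open>\<open>Y_of f p\<close> is the value of a fixed continuous function at \<open>p\<close> and the second-order jet of \<open>f\<close> at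
  \<open>p\<close>.\<close>

lemma agree_on_boundary_Y_of:
  assumes "agree_to_second_order \<Omega> f g"
  shows "agree_on_boundary \<Omega> (Y_of f) (Y_of g)"
proof -
  have a: "agree_on_boundary \<Omega> f g" "agree_on_boundary \<Omega> (sgrad f) (sgrad g)"
    "\<And>v. agree_on_boundary \<Omega> (\<lambda>p. shess f p v) (\<lambda>p. shess g p v)"
    using assms by (simp_all add: agree_to_second_order_def)
  let ?a = "\<lambda>i. axis i 1 :: real^3"
  let ?J = "\<lambda>f p. (f p, sgrad f p, shess f p (?a 1), shess f p (?a 2), shess f p (?a 3))"
  let ?l = "\<lambda>a b c :: real^3. a $ 1 + b $ 2 + c $ 3 :: real"
  let ?h = "\<lambda>(p :: real^3, y :: real, d :: real^3, a, b, c).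
    (d - (1/2 * ?l a b c) *\<^sub>R p, - (1/2) * (?l a b c + 2 * y))"
  have "agree_on_boundary \<Omega> (?J f) (?J g)"
    by (intro agree_on_boundary_Pair a)
  moreover have "continuous_on UNIV ?h"
    unfolding case_prod_beta by (intro continuous_intros)
  ultimately have agree: "agree_on_boundary \<Omega> (\<lambda>p. ?h (p, ?J f p)) (\<lambda>p. ?h (p, ?J g p))"
    by (rule agree_on_boundary_continuous)
  have "Y_of u = (\<lambda>p. ?h (p, ?J u p))" for u
    by (simp add: fun_eq_iff Y_of_def slaplacian_def trace_def matrix_def sum_3)
  from agree[folded this] show ?thesis .
qed

theorem proposition1p1:
  fixes \<Omega> :: "(real^3) set" and f :: "real^3 \<Rightarrow> real"
  assumes "sphere_domain \<Omega>"
    and "smooth_on_sphere f \<Omega>"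
  shows "marginally_trapped (immersed_part \<Omega> (Y_of f)) (Y_of f) \<and>
    (\<forall>g :: real^3 \<Rightarrow> real. smooth_on_sphere g \<Omega> \<and> agree_to_second_order \<Omega> f g \<longrightarrow>
       marginally_trapped_spherical_graph (immersed_part \<Omega> (Y_of g)) (Y_of g) \<and>
       (\<forall>\<nu>\<in>\<Omega>. (\<nu>, 1) \<in> normal_plane (Y_of g) \<nu>) \<and>
       agree_on_boundary \<Omega> (Y_of f) (Y_of g))"
proof (intro conjI allI impI)
  have \<Omega>: "openin (top_of_set S2) \<Omega>"
    using assms(1) by (simp add: sphere_domain_def)
  show "marginally_trapped (immersed_part \<Omega> (Y_of f)) (Y_of f)"
    unfolding marginally_trapped_def
    using spacelike_surface_Y_of[OF \<Omega> assms(2)] mean_curvature_vector_null[OF \<Omega> assms(2)] by blast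
  fix g :: "real^3 \<Rightarrow> real"
  assume g: "smooth_on_sphere g \<Omega> \<and> agree_to_second_order \<Omega> f g"
  then have g': "smooth_on_sphere g \<Omega>" by simp
  show null: "\<forall>\<nu>\<in>\<Omega>. (\<nu>, 1) \<in> normal_plane (Y_of g) \<nu>"
    using null_normal[OF \<Omega> g'] by blast
  show "marginally_trapped_spherical_graph (immersed_part \<Omega> (Y_of g)) (Y_of g)"
    unfolding marginally_trapped_spherical_graph_def spherical_graph_def
    using spacelike_surface_Y_of[OF \<Omega> g'] null mean_curvature_vector_Y_of(2)[OF \<Omega> g']
    by (simp add: immersed_part_def)
  show "agree_on_boundary \<Omega> (Y_of f) (Y_of g)"
    using g agree_on_boundary_Y_of by blast
qed

end
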